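(* Let $T>0$, $\gamma>0$, let $N\in\mathbb{N}$ with $N\ge 2$, and let $\tau=T/N$ (no other restriction on $\tau$). Let $\boldsymbol{u}_0,\boldsymbol{u}_1\in X_h$ be given, and let $(\boldsymbol{u}_{n+1},p_{n+1})\in X_h\times Y_h$, $n=1,\dots,N-1$, be generated by the generalized rotational IMEX scheme (all notation as in the context): for all $(\boldsymbol{w},q)\in X_h\times Y_h$, $$\Big\langle\tfrac{3}{2\tau}\boldsymbol{u}_{n+1}+\boldsymbol{u}^{\star}_{n+1}\cdot\nabla\boldsymbol{u}_{n+1},\boldsymbol{w}\Big\rangle+\big\langle\nu^{\star}_{n+1}\nabla\times\boldsymbol{u}_{n+1},\nabla\times\boldsymbol{w}\big\rangle+\gamma\big\langle\nu^{\star}_{n+1}\nabla\cdot\boldsymbol{u}_{n+1},\nabla\cdot\boldsymbol{w}\big\rangle+\langle\nabla\cdot\boldsymbol{u}_{n+1},q\rangle-\langle p_{n+1},\nabla\cdot\boldsymbol{w}\rangle$$ $$=\Big\langle\tfrac{4\boldsymbol{u}_n-\boldsymbol{u}_{n-1}}{2\tau}+2\big(2\nabla^{\top}\boldsymbol{u}_n\nabla\nu_n-\nabla^{\top}\boldsymbol{u}_{n-1}\nabla\nu_{n-1}\big),\boldsymbol{w}\Big\rangle .$$ Set $\tilde\gamma:=\min\{\gamma,1\}$. Then for any $\varepsilon\in(0,\tfrac1{40}]$, $$\|\boldsymbol{u}_N\|^2+\|\boldsymbol{u}^{\star}_{N+1}\|^2+8\varepsilon\tilde\gamma\tau\nu_{\min}\Big(5\|\nabla\boldsymbol{u}_N\|^2+\|\nabla\boldsymbol{u}_{N-1}\|^2\Big)+4(1-40\varepsilon)\tilde\gamma\tau\sum_{n=2}^{N}\nu_{\min}\|\nabla\boldsymbol{u}_n\|^2\le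 C\exp\Big(\frac{\|\nabla\nu\|_\infty^2\,T}{\varepsilon\,\tilde\gamma\,\nu_{\min}}\Big),$$ where $$C=\|\boldsymbol{u}^{\star}_2\|^2+\|\boldsymbol{u}_1\|^2+32\varepsilon\tilde\gamma\tau\nu_{\min}\big(5\|\nabla\boldsymbol{u}_1\|^2+\|\nabla\boldsymbol{u}_0\|^2\big).$$
   Context: $\Omega\subset\mathbb{R}^d$ ($d=2,3$) is a bounded domain with Lipschitz boundary, $Q=\Omega\times(0,T]$, and $t_n=n\tau$. $\langle\cdot,\cdot\rangle$ and $\|\cdot\|$ are the $L^2(\Omega)$ inner product and norm for scalars, vectors or tensors (Frobenius product for tensors), and $\|\cdot\|_\infty$ is the $L^\infty(\bar Q)$ norm. $X_h$ and $Y_h$ are the Taylor–Hood finite element spaces: continuous piecewise second-order velocities and continuous piecewise first-order pressures on a mesh of $\Omega$. The analysis is for zero body force and homogeneous Dirichlet conditions, i.e. all functions of $X_h$ vanish on $\partial\Omega$, so $X_h\subset H^1_0(\Omega)^d$. In particular $\boldsymbol{u}_n\in H^1_0(\Omega)^d$ for all $n$. Gradients: $(\nabla\boldsymbol{u})_{ij}=\partial_j u_i$, $(\nabla^{\top}\boldsymbol{u})_{ij}=\partial_i u_j$, so $(\nabla^{\top}\boldsymbol{u}\,\nabla\nu)_i=\sum_j \partial_i u_j\,\partial_j\nu$; and $(\boldsymbol{v}\cdot\nabla\boldsymbol{u})_i=\sum_j v_j\partial_j u_i$. $\nabla\times$ is the curl (for $d=2$, the scalar curl $\partial_1u_2-\partial_2u_1$).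 Extrapolated velocity: $\boldsymbol{u}^{\star}_{n+1}=2\boldsymbol{u}_n-\boldsymbol{u}_{n-1}$ for $n\ge1$. Viscosity: the field $\nu$ satisfies $0<\nu_{\min}\le\nu\le\nu_{\max}<\infty$. Either (i) $\nu(\boldsymbol{x},t)$ is prescribed, in which case $\nu_n=\nu(\cdot,t_n)$ and $\nu^{\star}_{n+1}=\nu(\cdot,t_{n+1})$; or (ii) it is given by a rheological law $\nu=\eta(\dot\gamma(\boldsymbol{u}))$ with $\eta$ taking values in $[\nu_{\min},\nu_{\max}]$, $\dot\gamma(\boldsymbol{u})=\sqrt{2\nabla^{\mathrm s}\boldsymbol{u}:\nabla^{\mathrm s}\boldsymbol{u}}$ and $\nabla^{\mathrm s}\boldsymbol{u}=\frac12(\nabla\boldsymbol{u}+\nabla^{\top}\boldsymbol{u})$, in which case $\nu_n=\eta(\dot\gamma(\boldsymbol{u}_n))$ and $\nu^{\star}_{n+1}=\eta(\dot\gamma(\boldsymbol{u}^{\star}_{n+1}))$ for $n\ge1$. It is assumed that $\nu_n\in W^{1,\infty}(\Omega)$ for all $n$, and $\|\nabla\nu\|_\infty<\infty$ bounds $\|\nabla\nu_n\|_{L^\infty(\Omega)}$ for all $n$ (in case (ii) it is the supremum of these norms over the time levels). The convective term is assumed skew-symmetric: $\langle\boldsymbol{u}^{\star}_{n+1}\cdot\nabla\boldsymbol{u}_{n+1},\boldsymbol{u}_{n+1}\rangle=0$ for $n=1,\dots,N-1$ (as is the case when $\nabla\cdot\boldsymbol{u}^{\star}_{n+1}=0$ in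 $\Omega$ and $\boldsymbol{u}^{\star}_{n+1}\cdot\boldsymbol{n}=0$ on $\partial\Omega$). *)

theory Defs
  imports "HOL-Analysis.Analysis" "HOL-Probability.Essential_Supremum"
begin

(* All functions on the domain Omega are total functions on real^'d. Only their values on Omega
   (on the closure of Omega for finite element functions) enter the definitions below. *)

definition L2_inner :: "'a::euclidean_space set \<Rightarrow> ('a \<Rightarrow> 'b::real_inner) \<Rightarrow> ('a \<Rightarrow> 'b) \<Rightarrow> real" where
  "L2_inner \<Omega> f g = (\<integral>x. f x \<bullet> g x \<partial>(lebesgue_on \<Omega>))"

definition L2_norm :: "'a::euclidean_space set \<Rightarrow> ('a \<Rightarrow> 'b::real_inner) \<Rightarrow> real" where
  "L2_norm \<Omega> f = sqrt (L2_inner \<Omega> f f)"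

definition Linf_norm :: "'a::euclidean_space set \<Rightarrow> ('a \<Rightarrow> 'b::euclidean_space) \<Rightarrow> ereal" where
  "Linf_norm \<Omega> f = esssup (lebesgue_on \<Omega>) (\<lambda>x. ereal (norm (f x)))"

(* The function phi is defined on the whole space, but used only on the hyperplane orthogonal to e;
   a Lipschitz function on (a part of) that hyperplane always extends. *)
definition lipschitz_domain :: "(real^'d) set \<Rightarrow> bool" where
  "lipschitz_domain \<Omega> \<longleftrightarrow>
     \<Omega> \<noteq> {} \<and> open \<Omega> \<and> connected \<Omega> \<and> bounded \<Omega> \<and>
     (\<forall>x \<in> frontier \<Omega>. \<exists>V e L \<phi>. open V \<and> x \<in> V \<and> norm e = 1 \<and> L-lipschitz_on UNIV \<phi> \<and>
        \<Omega> \<inter> V = {y \<in> V. y \<bullet> e < \<phi> (y - (y \<bullet> e) *\<^sub>R e)})"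

primrec k_times_differentiable :: "nat \<Rightarrow> ('a::euclidean_space \<Rightarrow> real) \<Rightarrow> bool" where
  "k_times_differentiable 0 f \<longleftrightarrow> True"
| "k_times_differentiable (Suc k) f \<longleftrightarrow>
     (\<forall>x. f differentiable (at x)) \<and>
     (\<forall>b \<in> Basis. k_times_differentiable k (\<lambda>x. frechet_derivative f (at x) b))"

definition test_functions :: "'a::euclidean_space set \<Rightarrow> ('a \<Rightarrow> real) set" where
  "test_functions U =
     {\<phi>. (\<forall>k. k_times_differentiable k \<phi>) \<and> (\<exists>K. compact K \<and> K \<subseteq> U \<and> (\<forall>x. x \<notin> K \<longrightarrow> \<phi> x = 0))}"

definition locally_integrable :: "'a::euclidean_space set \<Rightarrow> ('a \<Rightarrow> real) \<Rightarrow> bool" where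
  "locally_integrable U f \<longleftrightarrow> (\<forall>K. compact K \<and> K \<subseteq> U \<longrightarrow> integrable (lebesgue_on K) f)"

definition has_weak_derivative ::
    "'a::euclidean_space set \<Rightarrow> 'a \<Rightarrow> ('a \<Rightarrow> real) \<Rightarrow> ('a \<Rightarrow> real) \<Rightarrow> bool" where
  "has_weak_derivative U b f g \<longleftrightarrow> locally_integrable U f \<and> locally_integrable U g \<and>
     (\<forall>\<phi> \<in> test_functions U.
        (\<integral>x. f x * frechet_derivative \<phi> (at x) b \<partial>(lebesgue_on U)) =
        - (\<integral>x. g x * \<phi> x \<partial>(lebesgue_on U)))"

definition has_weak_gradient ::
    "(real^'d) set \<Rightarrow> (real^'d \<Rightarrow> real) \<Rightarrow> (real^'d \<Rightarrow> real^'d) \<Rightarrow> bool" where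
  "has_weak_gradient \<Omega> f G \<longleftrightarrow> (\<forall>i. has_weak_derivative \<Omega> (axis i 1) f (\<lambda>x. G x $ i))"

definition has_weak_spatial_gradient ::
    "(real^'d) set \<Rightarrow> real \<Rightarrow> ((real^'d) \<times> real \<Rightarrow> real) \<Rightarrow> ((real^'d) \<times> real \<Rightarrow> real^'d) \<Rightarrow> bool" where
  "has_weak_spatial_gradient \<Omega> T f G \<longleftrightarrow>
     (\<forall>i. has_weak_derivative (\<Omega> \<times> {0<..<T}) (axis i 1, 0) f (\<lambda>z. G z $ i))"

definition W1inf_gradient ::
    "(real^'d) set \<Rightarrow> (real^'d \<Rightarrow> real) \<Rightarrow> (real^'d \<Rightarrow> real^'d) \<Rightarrow> bool" where
  "W1inf_gradient \<Omega> f G \<longleftrightarrow>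
     f \<in> borel_measurable (lebesgue_on \<Omega>) \<and> Linf_norm \<Omega> f < \<infinity> \<and>
     G \<in> borel_measurable (lebesgue_on \<Omega>) \<and> Linf_norm \<Omega> G < \<infinity> \<and>
     has_weak_gradient \<Omega> f G"

(* Entry (i, j) of jacobian u (at x) is the partial derivative of u_i with respect to x_j. A finite
   element function is Lipschitz and differentiable in the interior of every mesh cell, so that its
   jacobian agrees almost everywhere with its weak gradient. *)
abbreviation grad :: "(real^'d \<Rightarrow> real^'d) \<Rightarrow> real^'d \<Rightarrow> real^'d^'d" where
  "grad u x \<equiv> jacobian u (at x)"

definition div_op :: "(real^'d \<Rightarrow> real^'d) \<Rightarrow> real^'d \<Rightarrow> real" where
  "div_op u x = trace (grad u x)"

definition curl2 :: "(real^2 \<Rightarrow> real^2) \<Rightarrow> real^2 \<Rightarrow> real" where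
  "curl2 u x = grad u x $ 2 $ 1 - grad u x $ 1 $ 2"

definition curl3 :: "(real^3 \<Rightarrow> real^3) \<Rightarrow> real^3 \<Rightarrow> real^3" where
  "curl3 u x = vector [grad u x $ 3 $ 2 - grad u x $ 2 $ 3,
                       grad u x $ 1 $ 3 - grad u x $ 3 $ 1,
                       grad u x $ 2 $ 1 - grad u x $ 1 $ 2]"

definition convection :: "(real^'d \<Rightarrow> real^'d) \<Rightarrow> (real^'d \<Rightarrow> real^'d) \<Rightarrow> real^'d \<Rightarrow> real^'d" where
  "convection v u x = grad u x *v v x"

definition sym_grad :: "(real^'d \<Rightarrow> real^'d) \<Rightarrow> real^'d \<Rightarrow> real^'d^'d" where
  "sym_grad u x = (1/2) *\<^sub>R (grad u x + transpose (grad u x))"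

definition shear_rate :: "(real^'d \<Rightarrow> real^'d) \<Rightarrow> real^'d \<Rightarrow> real" where
  "shear_rate u x = sqrt (2 * (sym_grad u x \<bullet> sym_grad u x))"

definition simplicial_mesh :: "(real^'d) set \<Rightarrow> (real^'d) set set \<Rightarrow> bool" where
  "simplicial_mesh \<Omega> \<T> \<longleftrightarrow>
     triangulation \<T> \<and> (\<forall>K \<in> \<T>. int CARD('d) simplex K) \<and> \<Union>\<T> = closure \<Omega>"

definition P1_polynomials :: "(real^'d \<Rightarrow> real) set" where
  "P1_polynomials = {q. \<exists>a b. \<forall>x. q x = a + b \<bullet> x}"

definition P2_polynomials :: "(real^'d \<Rightarrow> real) set" where
  "P2_polynomials = {q. \<exists>a b (A :: real^'d^'d). \<forall>x. q x = a + b \<bullet> x + x \<bullet> (A *v x)}"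

definition velocity_space ::
    "(real^'d) set \<Rightarrow> (real^'d) set set \<Rightarrow> (real^'d \<Rightarrow> real^'d) set" where
  "velocity_space \<Omega> \<T> =
     {w. continuous_on (closure \<Omega>) w \<and>
         (\<forall>K \<in> \<T>. \<forall>i. \<exists>q \<in> P2_polynomials. \<forall>x \<in> K. w x $ i = q x) \<and>
         (\<forall>x \<in> frontier \<Omega>. w x = 0)}"

definition pressure_space ::
    "(real^'d) set \<Rightarrow> (real^'d) set set \<Rightarrow> (real^'d \<Rightarrow> real) set" where
  "pressure_space \<Omega> \<T> =
     {p. continuous_on (closure \<Omega>) p \<and>
         (\<forall>K \<in> \<T>. \<exists>q \<in> P1_polynomials. \<forall>x \<in> K. p x = q x)}"

(* Because of the truncated subtraction, meaningful for n at least 2 only. *)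
definition ustar :: "(nat \<Rightarrow> real^'d \<Rightarrow> real^'d) \<Rightarrow> nat \<Rightarrow> real^'d \<Rightarrow> real^'d" where
  "ustar u n x = 2 *\<^sub>R u (n - 1) x - u (n - 2) x"

(* In the two viscosity models, nu n and nustar n are the viscosity and the extrapolated viscosity
   at the time level n, dnu n is the gradient of nu n, and kappa is the constant ||grad nu||_infinity. *)

definition prescribed_viscosity ::
    "(real^'d) set \<Rightarrow> real \<Rightarrow> nat \<Rightarrow> real \<Rightarrow> real \<Rightarrow>
     (nat \<Rightarrow> real^'d \<Rightarrow> real) \<Rightarrow> (nat \<Rightarrow> real^'d \<Rightarrow> real) \<Rightarrow> real \<Rightarrow> bool" where
  "prescribed_viscosity \<Omega> T N \<nu>\<^sub>m\<^sub>i\<^sub>n \<nu>\<^sub>m\<^sub>a\<^sub>x \<nu> \<nu>star \<kappa> \<longleftrightarrow>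
     (\<exists>(f :: (real^'d) \<times> real \<Rightarrow> real) G.
        (\<forall>t \<in> {0..T}. AE x in lebesgue_on \<Omega>. \<nu>\<^sub>m\<^sub>i\<^sub>n \<le> f (x, t) \<and> f (x, t) \<le> \<nu>\<^sub>m\<^sub>a\<^sub>x) \<and>
        (\<forall>n \<le> N. \<forall>x \<in> \<Omega>. \<nu> n x = f (x, real n * (T / real N))) \<and>
        (\<forall>n \<in> {1..<N}. \<forall>x \<in> \<Omega>. \<nu>star (n + 1) x = f (x, real (n + 1) * (T / real N))) \<and>
        has_weak_spatial_gradient \<Omega> T f G \<and>
        ereal \<kappa> = Linf_norm (\<Omega> \<times> {0<..T}) G)"

(* The shear rate is nonnegative, so only the values of eta on [0, infinity) are relevant. *)
definition rheological_viscosity ::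
    "(real^'d) set \<Rightarrow> nat \<Rightarrow> real \<Rightarrow> real \<Rightarrow> (nat \<Rightarrow> real^'d \<Rightarrow> real^'d) \<Rightarrow>
     (nat \<Rightarrow> real^'d \<Rightarrow> real) \<Rightarrow> (nat \<Rightarrow> real^'d \<Rightarrow> real) \<Rightarrow> (nat \<Rightarrow> real^'d \<Rightarrow> real^'d) \<Rightarrow> real \<Rightarrow> bool"
  where
  "rheological_viscosity \<Omega> N \<nu>\<^sub>m\<^sub>i\<^sub>n \<nu>\<^sub>m\<^sub>a\<^sub>x u \<nu> \<nu>star d\<nu> \<kappa> \<longleftrightarrow>
     (\<exists>\<eta> :: real \<Rightarrow> real.
        \<eta> \<in> borel_measurable (restrict_space borel {0..}) \<and>
        (\<forall>s \<ge> 0. \<nu>\<^sub>m\<^sub>i\<^sub>n \<le> \<eta> s \<and> \<eta> s \<le> \<nu>\<^sub>m\<^sub>a\<^sub>x) \<and>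
        (\<forall>n \<le> N. \<forall>x \<in> \<Omega>. \<nu> n x = \<eta> (shear_rate (u n) x)) \<and>
        (\<forall>n \<in> {1..<N}. \<forall>x \<in> \<Omega>. \<nu>star (n + 1) x = \<eta> (shear_rate (ustar u (n + 1)) x)) \<and>
        ereal \<kappa> = (SUP n \<in> {..N}. Linf_norm \<Omega> (d\<nu> n)))"

(* The curl is a parameter, since it is scalar for d = 2 and a vector for d = 3. *)
definition rotational_imex_step ::
    "((real^'d \<Rightarrow> real^'d) \<Rightarrow> real^'d \<Rightarrow> 'c::real_inner) \<Rightarrow>
     (real^'d) set \<Rightarrow> (real^'d) set set \<Rightarrow> real \<Rightarrow> real \<Rightarrow>
     (nat \<Rightarrow> real^'d \<Rightarrow> real^'d) \<Rightarrow> (nat \<Rightarrow> real^'d \<Rightarrow> real) \<Rightarrow>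
     (nat \<Rightarrow> real^'d \<Rightarrow> real) \<Rightarrow> (nat \<Rightarrow> real^'d \<Rightarrow> real^'d) \<Rightarrow> nat \<Rightarrow> bool" where
  "rotational_imex_step curl \<Omega> \<T> \<tau> \<gamma> u p \<nu>star d\<nu> n \<longleftrightarrow>
     (\<forall>w \<in> velocity_space \<Omega> \<T>. \<forall>q \<in> pressure_space \<Omega> \<T>.
        L2_inner \<Omega> (\<lambda>x. (3 / (2 * \<tau>)) *\<^sub>R u (n + 1) x + convection (ustar u (n + 1)) (u (n + 1)) x) w
        + L2_inner \<Omega> (\<lambda>x. \<nu>star (n + 1) x *\<^sub>R curl (u (n + 1)) x) (curl w)
        + \<gamma> * L2_inner \<Omega> (\<lambda>x. \<nu>star (n + 1) x * div_op (u (n + 1)) x) (div_op w)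
        + L2_inner \<Omega> (div_op (u (n + 1))) q
        - L2_inner \<Omega> (p (n + 1)) (div_op w)
      = L2_inner \<Omega>
          (\<lambda>x. (1 / (2 * \<tau>)) *\<^sub>R (4 *\<^sub>R u n x - u (n - 1) x)
             + 2 *\<^sub>R (2 *\<^sub>R (transpose (grad (u n) x) *v d\<nu> n x)
                      - transpose (grad (u (n - 1)) x) *v d\<nu> (n - 1) x)) w)"

end

theory Submission
  imports Defs
begin

text \<open>The scheme is tested with \<open>w = u\<^sub>n\<^sub>+\<^sub>1\<close> and \<open>q = p\<^sub>n\<^sub>+\<^sub>1\<close>. Pointwise, \<open>\<bar>\<nabla>\<times>u\<bar>\<^sup>2 + (\<nabla>\<cdot>u)\<^sup>2\<close> differs from
  \<open>\<bar>\<nabla>u\<bar>\<^sup>2\<close> by \<open>(tr \<nabla>u)\<^sup>2 - tr((\<nabla>u)\<^sup>2)\<close>, a sum of \<open>2 \<times> 2\<close> minors whose integral vanishes because \<open>u\<close>,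
  extended by zero, is Lipschitz with bounded support. So the viscous terms dominate
  \<open>\<nu>\<^sub>m\<^sub>i\<^sub>n min{\<gamma>,1} \<parallel>\<nabla>u\<parallel>\<^sup>2\<close>. In the explicit term one writes \<open>u\<^sub>n\<^sub>+\<^sub>1\<close> as \<open>u\<^sup>\<star>\<^sub>n\<^sub>+\<^sub>1\<close> plus the second difference,
  which is absorbed by the BDF2 dissipation. With \<open>h = \<epsilon> min{\<gamma>,1} \<nu>\<^sub>m\<^sub>i\<^sub>n\<close>, \<open>G\<^sub>n = h \<tau> \<parallel>\<nabla>u\<^sub>n\<parallel>\<^sup>2\<close> and
  \<open>F\<^sub>n = \<parallel>u\<^sub>n\<parallel>\<^sup>2 + \<parallel>u\<^sup>\<star>\<^sub>n\<^sub>+\<^sub>1\<parallel>\<^sup>2 + 32 (5 G\<^sub>n + G\<^sub>n\<^sub>-\<^sub>1)\<close> this gives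
  \<open>F\<^sub>n\<^sub>+\<^sub>1 + (4/\<epsilon> - 160) G\<^sub>n\<^sub>+\<^sub>1 \<le> (1 + \<tau> \<kappa>\<^sup>2/h) F\<^sub>n\<close>, which is iterated.\<close>

section \<open>Lipschitz functions with bounded support\<close>

lemma integral_lborel_shift:
  fixes f :: "'a::euclidean_space \<Rightarrow> 'b::{banach, second_countable_topology}"
  assumes [measurable]: "f \<in> borel_measurable borel"
  shows "(\<integral>x. f (x + c) \<partial>lborel) = (\<integral>x. f x \<partial>lborel)"
proof -
  have "(\<integral>x. f x \<partial>lborel) = (\<integral>x. f x \<partial>distr lborel borel ((+) c))"
    by (simp add: lborel_distr_plus)
  also have "\<dots> = (\<integral>x. f (c + x) \<partial>lborel)"
    by (rule integral_distr) auto
  finally show ?thesis by (simp add: add.commute)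
qed

lemma integrable_continuous_bounded_support:
  fixes f :: "'a::euclidean_space \<Rightarrow> real"
  assumes "continuous_on UNIV f" "\<And>x. r < norm x \<Longrightarrow> f x = 0"
  shows "integrable lborel f"
proof -
  have "integrable lborel (\<lambda>x. indicator (cball 0 r) x *\<^sub>R f x)"
    using assms(1) by (intro borel_integrable_compact) (auto intro: continuous_on_subset)
  moreover have "(\<lambda>x. indicator (cball 0 r) x *\<^sub>R f x) = f"
    using assms(2) by (force simp: indicator_def)
  ultimately show ?thesis by simp
qed

text \<open>Once divided by the step sizes, this is the identity between \<open>\<integral>\<partial>\<^sub>v f \<partial>\<^sub>w g\<close> and
  \<open>\<integral>\<partial>\<^sub>w f \<partial>\<^sub>v g\<close> for difference quotients: it is exact because both sides are the same
  combination of values of the correlation \<open>c \<mapsto> \<integral>f(x + c) g(x)\<close>.\<close>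

lemma integral_difference_swap:
  fixes f g :: "'a::euclidean_space \<Rightarrow> real"
  assumes f: "continuous_on UNIV f" and g: "continuous_on UNIV g"
    and f0: "\<And>x. r < norm x \<Longrightarrow> f x = 0"
  shows "(\<integral>x. (f (x + v) - f x) * (g (x + w) - g x) \<partial>lborel)
       = (\<integral>x. (f (x - w) - f x) * (g (x - v) - g x) \<partial>lborel)"
proof -
  have cf: "continuous_on UNIV (\<lambda>x. f (x + c))" and cg: "continuous_on UNIV (\<lambda>x. g (x + c))" for c
    by (rule continuous_on_compose2[OF f], auto intro!: continuous_intros)
       (rule continuous_on_compose2[OF g], auto intro!: continuous_intros)
  have int: "integrable lborel (\<lambda>x. f (x + a) * g (x + b))" for a b
  proof (rule integrable_continuous_bounded_support)
    show "continuous_on UNIV (\<lambda>x. f (x + a) * g (x + b))"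
      by (intro continuous_on_mult cf cg)
    show "f (x + a) * g (x + b) = 0" if "r + norm a < norm x" for x
      using f0[of "x + a"] that norm_triangle_ineq4[of "x + a" a] by simp
  qed
  note int' = int[of _ 0, simplified] int[of 0, simplified] int[of 0 0, simplified]
  have shift: "(\<integral>x. f (x + a) * g (x + b) \<partial>lborel) = (\<integral>x. f (x + (a + c)) * g (x + (b + c)) \<partial>lborel)" for a b c
  proof -
    have [measurable]: "(\<lambda>x. f (x + a) * g (x + b)) \<in> borel_measurable borel"
      by (intro borel_measurable_continuous_onI continuous_on_mult cf cg)
    show ?thesis
      using integral_lborel_shift[of "\<lambda>x. f (x + a) * g (x + b)" c] by (simp add: add.assoc add.commute add.left_commute)
  qed
  have expand: "(\<integral>x. (f (x + a) - f x) * (g (x + b) - g x) \<partial>lborel)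
     = (\<integral>x. f (x + a) * g (x + b) \<partial>lborel) - (\<integral>x. f (x + a) * g x \<partial>lborel)
     - (\<integral>x. f x * g (x + b) \<partial>lborel) + (\<integral>x. f x * g x \<partial>lborel)" for a b
  proof -
    have "(\<lambda>x. (f (x + a) - f x) * (g (x + b) - g x))
      = (\<lambda>x. f (x + a) * g (x + b) - f (x + a) * g x - f x * g (x + b) + f x * g x)"
      by (auto simp: algebra_simps)
    then show ?thesis using int[of a b] int' by simp
  qed
  \<comment> \<open>Translation by \<open>-v-w\<close> turns \<open>f (x + v) * g (x + w)\<close>
    into \<open>f (x - w) * g (x - v)\<close>. Translations by \<open>-v\<close> and
    \<open>-w\<close> exchange the mixed terms of the two expansions crosswise.\<close>
  show ?thesis
    using expand[of v w] expand[of "-w" "-v"] shift[of v w "-v-w"] shift[of v 0 "-v"] shift[of 0 w "-w"]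
    by simp
qed

text \<open>Fixing the steps \<open>1 / Suc n\<close> makes the directional derivative a limit of a
  sequence of continuous functions of \<open>x\<close>, which is the form that measurability and
  dominated convergence need.\<close>

lemma has_derivative_sequential_quotient:
  fixes f :: "'a::euclidean_space \<Rightarrow> real"
  assumes "(f has_derivative f') (at x)"
  shows "(\<lambda>n. real (Suc n) * (f (x + (1 / real (Suc n)) *\<^sub>R v) - f x)) \<longlonglongrightarrow> f' v"
proof -
  have lin: "linear f'" using assms has_derivative_linear by blast
  have "((\<lambda>t. f (x + t *\<^sub>R v)) has_derivative (\<lambda>t. f' (t *\<^sub>R v))) (at 0)"
  proof -
    have "((\<lambda>t. x + t *\<^sub>R v) has_derivative (\<lambda>t. t *\<^sub>R v)) (at 0)"
      by (auto intro!: derivative_eq_intros)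
    moreover have "(f has_derivative f') (at (x + 0 *\<^sub>R v))" using assms by simp
    ultimately show ?thesis
      by (rule has_derivative_compose)
  qed
  then have "((\<lambda>t. f (x + t *\<^sub>R v)) has_real_derivative f' v) (at 0)"
    unfolding has_field_derivative_def by (simp only: linear_cmul[OF lin] real_scaleR_def mult.commute[of _ "f' v"])
  then have "((\<lambda>h. (f (x + h *\<^sub>R v) - f x) / h) \<longlongrightarrow> f' v) (at 0)"
    by (simp add: DERIV_def)
  moreover have "filterlim (\<lambda>n. 1 / real (Suc n)) (at 0) sequentially"
    unfolding filterlim_at using LIMSEQ_inverse_real_of_nat by (auto simp: inverse_eq_divide)
  ultimately have "(\<lambda>n. (f (x + (1 / real (Suc n)) *\<^sub>R v) - f x) / (1 / real (Suc n))) \<longlonglongrightarrow> f' v"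
    by (rule filterlim_compose)
  then show ?thesis by (simp add: mult.commute)
qed

lemma continuous_on_shift:
  fixes f :: "'a::real_normed_vector \<Rightarrow> 'b::topological_space"
  assumes "continuous_on UNIV f"
  shows "continuous_on UNIV (\<lambda>x. f (x + c))"
  by (rule continuous_on_compose2[OF assms]) (auto intro: continuous_on_add continuous_on_id continuous_on_const)

lemma continuous_imp_measurable_lebesgue:
  fixes f :: "'a::euclidean_space \<Rightarrow> real"
  shows "continuous_on UNIV f \<Longrightarrow> f \<in> borel_measurable lebesgue"
  by (simp add: borel_measurable_continuous_onI measurable_completion)

text \<open>The derivative is almost everywhere the limit of continuous difference quotients, and
  completeness of Lebesgue measure disposes of the exceptional null set.\<close>

lemma AE_derivative_measurable:
  fixes f :: "'a::euclidean_space \<Rightarrow> real"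
  assumes f: "continuous_on UNIV f" and ae: "AE x in lebesgue. (f has_derivative f' x) (at x)"
  shows "(\<lambda>x. f' x v) \<in> borel_measurable lebesgue"
proof -
  define q where "q n x = real (Suc n) * (f (x + (1 / real (Suc n)) *\<^sub>R v) - f x)" for n x
  have "continuous_on UNIV (q n)" for n
    unfolding q_def by (intro continuous_on_mult_left continuous_on_diff continuous_on_shift f)
  then have "q n \<in> borel_measurable lebesgue" for n
    by (rule continuous_imp_measurable_lebesgue)
  then have "(\<lambda>x. lim (\<lambda>n. q n x)) \<in> borel_measurable lebesgue"
    by (rule borel_measurable_lim_metric)
  moreover have "AE x in lebesgue. lim (\<lambda>n. q n x) = f' x v"
    using ae unfolding q_def
    by eventually_elim (rule limI[OF has_derivative_sequential_quotient])
  ultimately show ?thesis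
    by (rule borel_measurable_AE)
qed

lemma lipschitz_quotient_bound:
  fixes f :: "'a::real_normed_vector \<Rightarrow> real"
  assumes L: "L-lipschitz_on UNIV f"
  shows "\<bar>real (Suc n) * (f (x + (1 / real (Suc n)) *\<^sub>R v) - f x)\<bar> \<le> L * norm v"
proof -
  have "\<bar>f (x + (1 / real (Suc n)) *\<^sub>R v) - f x\<bar> \<le> L * norm v / real (Suc n)"
    using lipschitz_onD[OF L, of "x + (1 / real (Suc n)) *\<^sub>R v" x] by (simp add: dist_norm)
  then show ?thesis
    by (simp add: abs_mult pos_le_divide_eq mult.commute del: of_nat_Suc)
qed

lemma lipschitz_derivative_bound:
  fixes f :: "'a::euclidean_space \<Rightarrow> real"
  assumes L: "L-lipschitz_on UNIV f" and d: "(f has_derivative f') (at x)"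
  shows "\<bar>f' v\<bar> \<le> L * norm v"
proof (rule LIMSEQ_le_const2)
  show "(\<lambda>n. \<bar>real (Suc n) * (f (x + (1 / real (Suc n)) *\<^sub>R v) - f x)\<bar>) \<longlonglongrightarrow> \<bar>f' v\<bar>"
    by (intro tendsto_rabs has_derivative_sequential_quotient d)
  show "\<exists>N. \<forall>n\<ge>N. \<bar>real (Suc n) * (f (x + (1 / real (Suc n)) *\<^sub>R v) - f x)\<bar> \<le> L * norm v"
    using lipschitz_quotient_bound[OF L] by blast
qed

text \<open>Dominated convergence: the Lipschitz constants bound both quotients uniformly in
  \<open>n\<close>, and the bounded support of \<open>f\<close> confines the products to one fixed
  ball.\<close>

lemma lipschitz_quotient_integral_limit:
  fixes f g :: "'a::euclidean_space \<Rightarrow> real"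
  assumes Lf: "L-lipschitz_on UNIV f" and Lg: "M-lipschitz_on UNIV g"
    and f0: "\<And>x. r < norm x \<Longrightarrow> f x = 0"
    and df: "AE x in lebesgue. (f has_derivative f' x) (at x)"
    and dg: "AE x in lebesgue. (g has_derivative g' x) (at x)"
  shows "(\<lambda>n. \<integral>x. (real (Suc n) * (f (x + (1 / real (Suc n)) *\<^sub>R v) - f x)) *
                  (real (Suc n) * (g (x + (1 / real (Suc n)) *\<^sub>R w) - g x)) \<partial>lborel)
         \<longlonglongrightarrow> (\<integral>x. f' x v * g' x w \<partial>lebesgue)"
proof -
  have f: "continuous_on UNIV f" and g: "continuous_on UNIV g"
    using Lf Lg lipschitz_on_continuous_on by blast+
  define F where "F n x = real (Suc n) * (f (x + (1 / real (Suc n)) *\<^sub>R v) - f x)" for n x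
  define G where "G n x = real (Suc n) * (g (x + (1 / real (Suc n)) *\<^sub>R w) - g x)" for n x
  have cont: "continuous_on UNIV (\<lambda>x. F n x * G n x)" for n
    unfolding F_def G_def
    by (intro continuous_on_mult continuous_on_const continuous_on_diff continuous_on_shift f g)
  then have meas: "(\<lambda>x. F n x * G n x) \<in> borel_measurable borel" for n
    by (rule borel_measurable_continuous_onI)
  \<comment> \<open>Every step \<open>v / Suc n\<close> has length at most \<open>norm v\<close>, so
    the quotient of \<open>f\<close> vanishes outside the ball of radius
    \<open>r + norm v\<close>.\<close>
  define W where "W x = (L * norm v) * (M * norm w) * indicator (cball 0 (r + norm v)) x" for x :: 'a
  have bF: "\<bar>F n x\<bar> \<le> L * norm v" for n x
    unfolding F_def by (rule lipschitz_quotient_bound[OF Lf])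
  have bG: "\<bar>G n x\<bar> \<le> M * norm w" for n x
    unfolding G_def by (rule lipschitz_quotient_bound[OF Lg])
  have bound: "norm (F n x * G n x) \<le> W x" for n x
  proof (cases "norm x \<le> r + norm v")
    case True
    have "\<bar>F n x\<bar> * \<bar>G n x\<bar> \<le> (L * norm v) * (M * norm w)"
      by (rule mult_mono[OF bF bG]) (use lipschitz_on_nonneg[OF Lf] in auto)
    with True show ?thesis by (simp add: W_def abs_mult)
  next
    case False
    have "norm ((1 / real (Suc n)) *\<^sub>R v) \<le> norm v"
      by (simp add: divide_le_eq mult_le_cancel_left1)
    then have "r < norm (x + (1 / real (Suc n)) *\<^sub>R v)"
      using False norm_diff_ineq[of x "(1 / real (Suc n)) *\<^sub>R v"] by linarith
    moreover have "r < norm x" using False norm_ge_zero[of v] by linarith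
    ultimately have "F n x = 0" by (simp add: F_def f0 del: of_nat_Suc)
    then show ?thesis
      using lipschitz_on_nonneg[OF Lf] lipschitz_on_nonneg[OF Lg] by (simp add: W_def)
  qed
  have "(\<lambda>n. \<integral>x. F n x * G n x \<partial>lebesgue) \<longlonglongrightarrow> (\<integral>x. f' x v * g' x w \<partial>lebesgue)"
  proof (rule integral_dominated_convergence)
    show "(\<lambda>x. f' x v * g' x w) \<in> borel_measurable lebesgue"
      by (intro borel_measurable_times AE_derivative_measurable[OF f df] AE_derivative_measurable[OF g dg])
    show "(\<lambda>x. F n x * G n x) \<in> borel_measurable lebesgue" for n
      by (rule continuous_imp_measurable_lebesgue[OF cont])
    show "integrable lebesgue W"
      unfolding W_def
      by (intro integrable_mult_right integrable_real_indicator)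
         (use emeasure_bounded_finite[OF bounded_cball, of 0 "r + norm v"] in auto)
    show "AE x in lebesgue. (\<lambda>n. F n x * G n x) \<longlonglongrightarrow> f' x v * g' x w"
      using df dg unfolding F_def G_def
      by eventually_elim (intro tendsto_mult has_derivative_sequential_quotient)
    show "AE x in lebesgue. norm (F n x * G n x) \<le> W x" for n
      using bound by simp
  qed
  \<comment> \<open>Continuous integrands have the same integral for \<open>lborel\<close> and for
    its completion \<open>lebesgue\<close>; the first suits translations, the second the
    limit.\<close>
  then show ?thesis
    using meas by (simp add: integral_completion F_def G_def)
qed

text \<open>This replaces two integrations by parts for functions without second derivatives: the
  exact identity for difference quotients is passed to the limit.\<close>

lemma lipschitz_integral_derivative_swap:
  fixes f g :: "'a::euclidean_space \<Rightarrow> real"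
  assumes Lf: "L-lipschitz_on UNIV f" and Lg: "M-lipschitz_on UNIV g"
    and f0: "\<And>x. r < norm x \<Longrightarrow> f x = 0"
    and df: "AE x in lebesgue. (f has_derivative f' x) (at x)"
    and dg: "AE x in lebesgue. (g has_derivative g' x) (at x)"
  shows "(\<integral>x. f' x v * g' x w \<partial>lebesgue) = (\<integral>x. f' x w * g' x v \<partial>lebesgue)"
proof -
  let ?q = "\<lambda>n (h :: 'a \<Rightarrow> real) v x. real (Suc n) * (h (x + (1 / real (Suc n)) *\<^sub>R v) - h x)"
  have f: "continuous_on UNIV f" and g: "continuous_on UNIV g"
    using Lf Lg lipschitz_on_continuous_on by blast+
  have eq: "(\<integral>x. ?q n f v x * ?q n g w x \<partial>lborel) = (\<integral>x. ?q n f (-w) x * ?q n g (-v) x \<partial>lborel)" for n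
  proof -
    have s: "(\<integral>x. (real (Suc n) * a x) * (real (Suc n) * b x) \<partial>lborel) = (real (Suc n))\<^sup>2 * (\<integral>x. a x * b x \<partial>lborel)"
      for a b :: "'a \<Rightarrow> real"
    proof -
      have "(\<lambda>x. (real (Suc n) * a x) * (real (Suc n) * b x)) = (\<lambda>x. (real (Suc n))\<^sup>2 * (a x * b x))"
        by (auto simp: power2_eq_square)
      then show ?thesis by (simp del: of_nat_Suc)
    qed
    show ?thesis
      unfolding s
      using integral_difference_swap[OF f g f0, where v="(1 / real (Suc n)) *\<^sub>R v" and w="(1 / real (Suc n)) *\<^sub>R w"]
      by simp
  qed
  note lim = lipschitz_quotient_integral_limit[OF Lf Lg f0 df dg]
  \<comment> \<open>The discrete identity produces the directions \<open>-w\<close> and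
    \<open>-v\<close>; after the limit both signs cancel by linearity of the derivatives.\<close>
  have "(\<integral>x. f' x v * g' x w \<partial>lebesgue) = (\<integral>x. f' x (-w) * g' x (-v) \<partial>lebesgue)"
    using lim[where v = v and w = w] lim[where v = "-w" and w = "-v"] unfolding eq by (rule LIMSEQ_unique)
  also have "\<dots> = (\<integral>x. f' x w * g' x v \<partial>lebesgue)"
  proof (rule integral_cong_AE)
    show "(\<lambda>x. f' x (-w) * g' x (-v)) \<in> borel_measurable lebesgue"
         "(\<lambda>x. f' x w * g' x v) \<in> borel_measurable lebesgue"
      by (intro borel_measurable_times AE_derivative_measurable[OF f df] AE_derivative_measurable[OF g dg])+
    show "AE x in lebesgue. f' x (-w) * g' x (-v) = f' x w * g' x v"
      using df dg
      by eventually_elim (auto dest!: has_derivative_linear simp: linear_neg)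
  qed
  finally show ?thesis .
qed

section \<open>Finite element functions extended by zero\<close>

lemma P2_polynomial_lipschitz:
  fixes K :: "(real^'d) set"
  assumes "q \<in> P2_polynomials" "bounded K"
  shows "\<exists>L. L-lipschitz_on K q"
proof -
  obtain a b and A :: "real^'d^'d" where q: "\<And>x. q x = a + b \<bullet> x + x \<bullet> (A *v x)"
    using assms(1) unfolding P2_polynomials_def by blast
  obtain R where R: "R > 0" "\<And>x. x \<in> K \<Longrightarrow> norm x \<le> R"
    using assms(2) unfolding bounded_pos by blast
  obtain B where B: "B > 0" "\<And>x. norm (A *v x) \<le> norm x * B"
    using bounded_linear.pos_bounded[OF matrix_vector_mul_bounded_linear[of A]] by blast
  have "(norm b + 2 * R * B)-lipschitz_on K q"
  proof (rule lipschitz_onI)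
    fix x y assume x: "x \<in> K" and y: "y \<in> K"
    \<comment> \<open>The splitting of the quadratic part leaves one factor \<open>x - y\<close> in
      each term; the other factors are bounded by \<open>R\<close> and \<open>B\<close> because
      \<open>K\<close> is bounded.\<close>
    have "q x - q y = b \<bullet> (x - y) + (x - y) \<bullet> (A *v x) + y \<bullet> (A *v (x - y))"
      by (simp add: q inner_diff_left inner_diff_right matrix_vector_mult_diff_distrib)
    moreover have "\<bar>b \<bullet> (x - y)\<bar> \<le> norm b * norm (x - y)"
      by (rule Cauchy_Schwarz_ineq2)
    moreover have "\<bar>(x - y) \<bullet> (A *v x)\<bar> \<le> norm (x - y) * (R * B)"
      using R(2)[OF x] B by (intro order_trans[OF Cauchy_Schwarz_ineq2] mult_left_mono order_trans[OF B(2)]) auto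
    moreover have "\<bar>y \<bullet> (A *v (x - y))\<bar> \<le> R * (norm (x - y) * B)"
      using R(2)[OF y] R(1) by (intro order_trans[OF Cauchy_Schwarz_ineq2] mult_mono B(2)) auto
    ultimately have "\<bar>q x - q y\<bar> \<le> norm b * norm (x - y) + norm (x - y) * (R * B) + R * (norm (x - y) * B)"
      by linarith
    then show "dist (q x) (q y) \<le> (norm b + 2 * R * B) * dist x y"
      by (simp add: dist_norm algebra_simps)
  qed (use R B in simp)
  then show ?thesis by blast
qed

lemma P2_polynomial_differentiable:
  assumes "q \<in> P2_polynomials"
  shows "q differentiable (at x)"
proof -
  obtain a b A where q: "q = (\<lambda>x. a + b \<bullet> x + x \<bullet> (A *v x))"
    using assms unfolding P2_polynomials_def by blast
  have "(\<lambda>x. A *v x) differentiable (at x)"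
    using bounded_linear_imp_differentiable matrix_vector_mul_bounded_linear by blast
  then show ?thesis unfolding q by simp
qed

lemma P2_polynomial_linear_combination:
  assumes "q \<in> P2_polynomials" "r \<in> P2_polynomials"
  shows "(\<lambda>x. s * q x + t * r x) \<in> P2_polynomials"
proof -
  obtain a b A where q: "\<And>x. q x = a + b \<bullet> x + x \<bullet> (A *v x)"
    using assms(1) unfolding P2_polynomials_def by blast
  obtain a' b' A' where r: "\<And>x. r x = a' + b' \<bullet> x + x \<bullet> (A' *v x)"
    using assms(2) unfolding P2_polynomials_def by blast
  have "s * q x + t * r x = (s * a + t * a') + (s *\<^sub>R b + t *\<^sub>R b') \<bullet> x + x \<bullet> ((s *\<^sub>R A + t *\<^sub>R A') *v x)" for x
    by (simp add: q r inner_left_distrib inner_right_distrib matrix_vector_mult_add_rdistrib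
        scaleR_matrix_vector_assoc[symmetric] algebra_simps)
  then show ?thesis unfolding P2_polynomials_def by blast
qed

lemma velocity_space_linear_combination:
  assumes "u \<in> velocity_space \<Omega> \<T>" "v \<in> velocity_space \<Omega> \<T>"
  shows "(\<lambda>x. s *\<^sub>R u x + t *\<^sub>R v x) \<in> velocity_space \<Omega> \<T>"
proof -
  have "\<exists>q \<in> P2_polynomials. \<forall>x \<in> K. (s *\<^sub>R u x + t *\<^sub>R v x) $ i = q x" if "K \<in> \<T>" for K i
  proof -
    obtain q where "q \<in> P2_polynomials" "\<forall>x\<in>K. u x $ i = q x"
      using assms(1) \<open>K \<in> \<T>\<close> unfolding velocity_space_def by blast
    moreover obtain r where "r \<in> P2_polynomials" "\<forall>x\<in>K. v x $ i = r x"
      using assms(2) \<open>K \<in> \<T>\<close> unfolding velocity_space_def by blast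
    ultimately show ?thesis
      by (intro bexI[of _ "\<lambda>x. s * q x + t * r x"] P2_polynomial_linear_combination) auto
  qed
  then show ?thesis
    using assms unfolding velocity_space_def by (auto intro!: continuous_intros)
qed

text \<open>Members of \<open>velocity_space\<close> are unconstrained off the closure of \<Omega>.
  The extension overwrites those values, so that translations in the whole space become
  meaningful.\<close>

definition zero_extension :: "'a set \<Rightarrow> ('a \<Rightarrow> 'b::zero) \<Rightarrow> 'a \<Rightarrow> 'b" where
  "zero_extension \<Omega> u x = (if x \<in> \<Omega> then u x else 0)"

lemma simplicial_meshD:
  assumes "simplicial_mesh \<Omega> \<T>"
  shows "finite \<T>" "K \<in> \<T> \<Longrightarrow> compact K" "K \<in> \<T> \<Longrightarrow> convex K" "\<Union>\<T> = closure \<Omega>"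
  using assms compact_simplex convex_simplex unfolding simplicial_mesh_def triangulation_def by blast+

text \<open>A point of a cell outside \<Omega> lies on the frontier, where the boundary condition
  makes \<open>u\<close> vanish.\<close>

lemma zero_extension_eq_on_mesh:
  assumes "simplicial_mesh \<Omega> \<T>" "u \<in> velocity_space \<Omega> \<T>" "K \<in> \<T>" "x \<in> K"
  shows "zero_extension \<Omega> u x = u x"
proof -
  have "x \<in> closure \<Omega>" using assms simplicial_meshD(4) by blast
  then have "x \<in> \<Omega> \<or> x \<in> frontier \<Omega>"
    using closure_Un_frontier[of \<Omega>] by blast
  then show ?thesis
    using assms(2) by (auto simp: zero_extension_def velocity_space_def)
qed

lemma lipschitz_on_vec:
  fixes u :: "'a::metric_space \<Rightarrow> real^'d"
  assumes "\<And>i. (L i)-lipschitz_on K (\<lambda>x. u x $ i)"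
  shows "(\<Sum>i\<in>UNIV. L i)-lipschitz_on K u"
proof (rule lipschitz_onI)
  fix x y assume "x \<in> K" "y \<in> K"
  have "dist (u x) (u y) \<le> (\<Sum>i\<in>UNIV. \<bar>(u x - u y) $ i\<bar>)"
    unfolding dist_norm by (rule norm_le_l1_cart)
  also have "\<dots> \<le> (\<Sum>i\<in>UNIV. L i * dist x y)"
    using lipschitz_onD[OF assms \<open>x \<in> K\<close> \<open>y \<in> K\<close>] by (intro sum_mono) (simp add: dist_norm)
  finally show "dist (u x) (u y) \<le> (\<Sum>i\<in>UNIV. L i) * dist x y"
    by (simp add: sum_distrib_right)
qed (use assms lipschitz_on_nonneg in \<open>blast intro: sum_nonneg\<close>)

text \<open>Along the segment from \<open>x\<close> to \<open>y\<close> the closed pieces pull back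
  to a finite closed cover of an interval, where Lipschitz bounds can be glued. The whole space
  contains every such segment, so the constant does not grow.\<close>

lemma lipschitz_on_closed_cover:
  fixes f :: "'a::real_normed_vector \<Rightarrow> 'b::metric_space"
  assumes fin: "finite \<C>" and cov: "\<Union>\<C> = UNIV"
    and cl: "\<And>S. S \<in> \<C> \<Longrightarrow> closed S" and lip: "\<And>S. S \<in> \<C> \<Longrightarrow> M-lipschitz_on S f" and "M \<ge> 0"
  shows "M-lipschitz_on UNIV f"
proof (rule lipschitz_onI)
  fix x y :: 'a
  define p where "p t = x + t *\<^sub>R (y - x)" for t :: real
  have pcont: "continuous_on UNIV p" unfolding p_def by (intro continuous_intros)
  have "(M * norm (y - x))-lipschitz_on {0..1} (f \<circ> p)"
  proof (rule lipschitz_on_closed_Union[where I = \<C> and U = "\<lambda>S. p -` S"])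
    fix S assume S: "S \<in> \<C>"
    show "closed (p -` S)"
      using pcont cl[OF S] by (simp add: closed_vimage continuous_on_eq_continuous_at continuous_at_imp_continuous_on)
    show "(M * norm (y - x))-lipschitz_on (p -` S) (f \<circ> p)"
    proof (rule lipschitz_onI)
      fix s t assume "s \<in> p -` S" "t \<in> p -` S"
      then have "dist (f (p s)) (f (p t)) \<le> M * dist (p s) (p t)"
        using lipschitz_onD[OF lip[OF S]] by simp
      moreover have "dist (p s) (p t) = \<bar>s - t\<bar> * norm (y - x)"
        by (simp add: p_def dist_norm scaleR_diff_left[symmetric])
      ultimately show "dist ((f \<circ> p) s) ((f \<circ> p) t) \<le> M * norm (y - x) * dist s t"
        by (simp add: dist_norm mult_ac)
    qed (use \<open>M \<ge> 0\<close> in simp)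
  qed (use fin cov \<open>M \<ge> 0\<close> in auto)
  then show "dist (f x) (f y) \<le> M * dist x y"
    using lipschitz_onD[of _ "{0..1}" "f \<circ> p" 0 1] by (simp add: p_def dist_norm norm_minus_commute)
qed (rule \<open>M \<ge> 0\<close>)

text \<open>The cells and the closed set \<open>- \<Omega>\<close> cover the space. The extension is
  polynomial on each cell and zero on \<open>- \<Omega>\<close>, and the sum of the cell constants
  serves all pieces at once.\<close>

lemma velocity_space_lipschitz:
  assumes op: "open \<Omega>" and mesh: "simplicial_mesh \<Omega> \<T>" and u: "u \<in> velocity_space \<Omega> \<T>"
  shows "\<exists>M. M-lipschitz_on UNIV (zero_extension \<Omega> u)"
proof -
  have "\<exists>L. L-lipschitz_on K (zero_extension \<Omega> u)" if K: "K \<in> \<T>" for K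
  proof -
    have "\<exists>L. L-lipschitz_on K (\<lambda>x. zero_extension \<Omega> u x $ i)" for i
    proof -
      obtain q where q: "q \<in> P2_polynomials" "\<forall>x\<in>K. u x $ i = q x"
        using u K unfolding velocity_space_def by blast
      obtain L where "L-lipschitz_on K q"
        using P2_polynomial_lipschitz[OF q(1)] simplicial_meshD(2)[OF mesh K] compact_imp_bounded by blast
      then have "L-lipschitz_on K (\<lambda>x. zero_extension \<Omega> u x $ i)"
        by (rule lipschitz_on_transform) (use q(2) zero_extension_eq_on_mesh[OF mesh u K] in auto)
      then show ?thesis ..
    qed
    then obtain L where "\<And>i. (L i)-lipschitz_on K (\<lambda>x. zero_extension \<Omega> u x $ i)" by metis
    then show ?thesis using lipschitz_on_vec by blast
  qed
  then obtain L where L: "\<And>K. K \<in> \<T> \<Longrightarrow> (L K)-lipschitz_on K (zero_extension \<Omega> u)" by metis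
  have nn: "K \<in> \<T> \<Longrightarrow> 0 \<le> L K" for K using L lipschitz_on_nonneg by blast
  have "(\<Sum>K\<in>\<T>. L K)-lipschitz_on UNIV (zero_extension \<Omega> u)"
  proof (rule lipschitz_on_closed_cover[where \<C> = "insert (- \<Omega>) \<T>"])
    show "(\<Sum>K\<in>\<T>. L K)-lipschitz_on S (zero_extension \<Omega> u)" if "S \<in> insert (- \<Omega>) \<T>" for S
    proof (cases "S \<in> \<T>")
      case True
      then have "L S \<le> (\<Sum>K\<in>\<T>. L K)"
        using nn simplicial_meshD(1)[OF mesh] by (intro member_le_sum) auto
      with True show ?thesis by (blast intro: lipschitz_on_mono[OF L])
    next
      case False
      with that have "S = - \<Omega>" by blast
      then show ?thesis
        using nn by (intro lipschitz_onI) (auto simp: zero_extension_def sum_nonneg)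
    qed
    show "\<Union> (insert (- \<Omega>) \<T>) = UNIV"
      using simplicial_meshD(4)[OF mesh] closure_subset[of \<Omega>] by auto
    show "closed S" if "S \<in> insert (- \<Omega>) \<T>" for S
      using that op simplicial_meshD(2)[OF mesh] compact_imp_closed by auto
  qed (use nn simplicial_meshD(1)[OF mesh] in \<open>auto intro: sum_nonneg\<close>)
  then show ?thesis ..
qed

lemma skeleton_negligible:
  assumes "simplicial_mesh \<Omega> \<T>"
  shows "negligible (\<Union>K\<in>\<T>. frontier K)"
  using simplicial_meshD(1,3)[OF assms] by (auto intro: negligible_Union negligible_convex_frontier)

lemma zero_extension_has_derivative_outside:
  fixes u :: "'a::real_normed_vector \<Rightarrow> 'b::real_normed_vector"
  assumes "x \<notin> closure \<Omega>"
  shows "(zero_extension \<Omega> u has_derivative (\<lambda>_. 0)) (at x)"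
proof -
  have "0 = zero_extension \<Omega> u y" if "y \<in> - closure \<Omega>" for y
    using that closure_subset[of \<Omega>] by (auto simp: zero_extension_def)
  then show ?thesis
    using assms by (intro has_derivative_transform_within_open[OF has_derivative_const, of "- closure \<Omega>"]) auto
qed

text \<open>A point off all cell boundaries is either interior to a cell, where each component is a
  polynomial, or outside the closure of \<Omega>, where the extension is locally zero.\<close>

lemma zero_extension_differentiable_off_skeleton:
  assumes mesh: "simplicial_mesh \<Omega> \<T>" and u: "u \<in> velocity_space \<Omega> \<T>"
    and x: "x \<notin> (\<Union>K\<in>\<T>. frontier K)"
  shows "zero_extension \<Omega> u differentiable (at x)"
proof (cases "x \<in> closure \<Omega>")
  case True
  then obtain K where K: "K \<in> \<T>" "x \<in> K" using simplicial_meshD(4)[OF mesh] by blast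
  then have xK: "x \<in> interior K" using x by (auto simp: frontier_def closure_subset[THEN subsetD])
  have "(\<lambda>x. zero_extension \<Omega> u x $ i) differentiable (at x)" for i
  proof -
    obtain q where q: "q \<in> P2_polynomials" "\<forall>x\<in>K. u x $ i = q x"
      using u K unfolding velocity_space_def by blast
    obtain q' where "(q has_derivative q') (at x)"
      using P2_polynomial_differentiable[OF q(1), of x] unfolding differentiable_def by blast
    then have "((\<lambda>x. zero_extension \<Omega> u x $ i) has_derivative q') (at x)"
      by (rule has_derivative_transform_within_open[OF _ open_interior xK])
         (use q(2) zero_extension_eq_on_mesh[OF mesh u K(1)] interior_subset[of K] in \<open>simp add: subset_iff\<close>)
    then show ?thesis unfolding differentiable_def by blast
  qed
  then show ?thesis
    unfolding differentiable_componentwise_within[of "zero_extension \<Omega> u"]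
    by (simp add: Basis_vec_def inner_axis)
next
  case False
  show ?thesis
    by (rule differentiableI[OF zero_extension_has_derivative_outside[OF False]])
qed

text \<open>A Lipschitz domain is the interior of its closure, so that its boundary cannot meet the
  interior of a mesh cell.\<close>

lemma lipschitz_domain_frontier_above:
  assumes dom: "lipschitz_domain \<Omega>" and x: "x \<in> frontier \<Omega>" and W: "open W" "x \<in> W"
  shows "\<not> W \<subseteq> closure \<Omega>"
proof -
  obtain V e L \<phi> where V: "open V" "x \<in> V" "norm e = 1" and \<phi>: "L-lipschitz_on UNIV \<phi>"
    and graph: "\<Omega> \<inter> V = {y \<in> V. y \<bullet> e < \<phi> (y - (y \<bullet> e) *\<^sub>R e)}"
    using dom x unfolding lipschitz_domain_def by blast
  have ee: "e \<bullet> e = 1" using V(3) by (simp add: dot_square_norm)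
  have "x \<notin> \<Omega>" using dom x by (simp add: lipschitz_domain_def frontier_def interior_open)
  then have xe: "\<phi> (x - (x \<bullet> e) *\<^sub>R e) \<le> x \<bullet> e" using graph V(2) by force
  obtain \<delta> where \<delta>: "\<delta> > 0" "ball x \<delta> \<subseteq> V \<inter> W"
    using open_contains_ball[of "V \<inter> W"] V W by blast
  \<comment> \<open>Moving up from \<open>x\<close> along \<open>e\<close> enters the region
    strictly above the graph, which is open and misses \<Omega> inside \<open>V\<close>.\<close>
  define y where "y = x + (\<delta> / 2) *\<^sub>R e"
  have y: "y \<in> V" "y \<in> W" using \<delta> V(3) by (auto simp: y_def dist_norm subset_iff)
  have "y - (y \<bullet> e) *\<^sub>R e = x - (x \<bullet> e) *\<^sub>R e" "y \<bullet> e = x \<bullet> e + \<delta> / 2"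
    by (simp_all add: y_def inner_left_distrib ee scaleR_add_left)
  then have above: "\<phi> (y - (y \<bullet> e) *\<^sub>R e) < y \<bullet> e" using xe \<delta> by simp
  have "continuous_on UNIV (\<lambda>z. \<phi> (z - (z \<bullet> e) *\<^sub>R e))"
    by (rule continuous_on_compose2[OF lipschitz_on_continuous_on[OF \<phi>]]) (auto intro!: continuous_intros)
  then have "open {z. \<phi> (z - (z \<bullet> e) *\<^sub>R e) < z \<bullet> e}"
    by (intro open_Collect_less continuous_intros)
  then have "open (V \<inter> {z. \<phi> (z - (z \<bullet> e) *\<^sub>R e) < z \<bullet> e})" using V by blast
  moreover have "V \<inter> {z. \<phi> (z - (z \<bullet> e) *\<^sub>R e) < z \<bullet> e} \<inter> \<Omega> = {}" using graph by force
  ultimately have "y \<notin> closure \<Omega>"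
    using above y(1) open_Int_closure_eq_empty by blast
  with y(2) show ?thesis by blast
qed

text \<open>Each frontier point lies in some cell, but not in its interior, which is an open subset
  of the closure. So the frontier is contained in the null set of cell boundaries.\<close>

lemma lipschitz_domain_frontier_negligible:
  assumes dom: "lipschitz_domain \<Omega>" and mesh: "simplicial_mesh \<Omega> \<T>"
  shows "negligible (frontier \<Omega>)"
proof (rule negligible_subset[OF skeleton_negligible[OF mesh]], rule subsetI)
  fix x assume x: "x \<in> frontier \<Omega>"
  then obtain K where K: "K \<in> \<T>" "x \<in> K"
    using simplicial_meshD(4)[OF mesh] by (auto simp: frontier_def)
  have "interior K \<subseteq> closure \<Omega>"
    using K simplicial_meshD(4)[OF mesh] interior_subset by blast
  then have "x \<notin> interior K"
    using lipschitz_domain_frontier_above[OF dom x open_interior] by blast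
  then have "x \<in> frontier K" using K closure_subset by (auto simp: frontier_def)
  with K show "x \<in> (\<Union>K\<in>\<T>. frontier K)" by blast
qed

section \<open>Essentially bounded functions\<close>

text \<open>Measurability and the bound are bundled so that the property is closed under sums and
  products. On a finite measure space it then yields every integrability claim below by one set of
  introduction rules.\<close>

definition ess_bounded :: "'a measure \<Rightarrow> ('a \<Rightarrow> 'b::real_normed_vector) \<Rightarrow> bool" where
  "ess_bounded M f \<longleftrightarrow> f \<in> borel_measurable M \<and> (\<exists>B. AE x in M. norm (f x) \<le> B)"

lemma ess_bounded_bilinear:
  fixes f :: "'a \<Rightarrow> 'b::{real_normed_vector, second_countable_topology}"
    and g :: "'a \<Rightarrow> 'c::{real_normed_vector, second_countable_topology}"
  assumes h: "bounded_bilinear h" and "ess_bounded M f" "ess_bounded M g"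
  shows "ess_bounded M (\<lambda>x. h (f x) (g x))"
proof -
  interpret bounded_bilinear h by (rule h)
  obtain B C where B: "AE x in M. norm (f x) \<le> B" and C: "AE x in M. norm (g x) \<le> C"
    using assms unfolding ess_bounded_def by blast
  obtain K where K: "0 \<le> K" "\<And>a b. norm (h a b) \<le> norm a * norm b * K"
    using nonneg_bounded by blast
  have "AE x in M. norm (h (f x) (g x)) \<le> B * C * K"
    using B C
  proof eventually_elim
    case (elim x)
    then have "norm (f x) * norm (g x) * K \<le> B * C * K"
      using K(1) norm_ge_zero[of "f x"] norm_ge_zero[of "g x"] by (intro mult_right_mono mult_mono) linarith+
    then show ?case using K(2) order_trans by blast
  qed
  moreover have "(\<lambda>x. h (f x) (g x)) \<in> borel_measurable M"
  proof (rule borel_measurable_continuous_Pair)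
    show "continuous_on UNIV (\<lambda>x. h (fst x) (snd x))"
      by (intro continuous_on continuous_on_fst continuous_on_snd continuous_on_id)
  qed (use assms(2,3) in \<open>auto simp: ess_bounded_def\<close>)
  ultimately show ?thesis unfolding ess_bounded_def by blast
qed

lemmas ess_bounded_inner = ess_bounded_bilinear[OF bounded_bilinear_inner]
  and ess_bounded_scaleR = ess_bounded_bilinear[OF bounded_bilinear_scaleR]
  and ess_bounded_mult = ess_bounded_bilinear[OF bounded_bilinear_mult]

lemma ess_bounded_const: "ess_bounded M (\<lambda>x. c)"
  unfolding ess_bounded_def by auto

lemma ess_bounded_add:
  fixes f g :: "'a \<Rightarrow> 'b::{real_normed_vector, second_countable_topology}"
  assumes "ess_bounded M f" "ess_bounded M g"
  shows "ess_bounded M (\<lambda>x. f x + g x)"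
proof -
  obtain B C where "AE x in M. norm (f x) \<le> B" "AE x in M. norm (g x) \<le> C"
    using assms unfolding ess_bounded_def by blast
  then have "AE x in M. norm (f x + g x) \<le> B + C"
    by eventually_elim (rule norm_add_rule_thm)
  then show ?thesis using assms unfolding ess_bounded_def by auto
qed

lemma ess_bounded_diff:
  fixes f g :: "'a \<Rightarrow> 'b::{real_normed_vector, second_countable_topology}"
  assumes "ess_bounded M f" "ess_bounded M g"
  shows "ess_bounded M (\<lambda>x. f x - g x)"
  using ess_bounded_add[OF assms(1) ess_bounded_scaleR[OF ess_bounded_const[of M "-1"] assms(2)]] by simp

lemma ess_bounded_sum:
  fixes f :: "'i \<Rightarrow> 'a \<Rightarrow> 'b::{real_normed_vector, second_countable_topology}"
  assumes "\<And>i. i \<in> I \<Longrightarrow> ess_bounded M (f i)"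
  shows "ess_bounded M (\<lambda>x. \<Sum>i\<in>I. f i x)"
  using assms by (induction I rule: infinite_finite_induct) (auto intro: ess_bounded_const ess_bounded_add)

lemma ess_bounded_nth:
  fixes f :: "'a \<Rightarrow> 'b::euclidean_space ^ 'n"
  assumes "ess_bounded M f"
  shows "ess_bounded M (\<lambda>x. f x $ i)"
proof -
  obtain B where "AE x in M. norm (f x) \<le> B" using assms unfolding ess_bounded_def by blast
  then have "AE x in M. norm (f x $ i) \<le> B"
    by eventually_elim (rule order_trans[OF Finite_Cartesian_Product.norm_nth_le])
  moreover have "f \<in> borel_measurable M" using assms unfolding ess_bounded_def by blast
  then have "(\<lambda>x. f x $ i) \<in> borel_measurable M"
    by (rule borel_measurable_continuous_on[OF linear_continuous_on[OF bounded_linear_vec_nth]])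
  ultimately show ?thesis unfolding ess_bounded_def by blast
qed

text \<open>Applied once to vectors and twice to matrices, this reduces the operations of linear
  algebra to scalar entries.\<close>

lemma ess_bounded_vec:
  fixes f :: "'a \<Rightarrow> 'b::euclidean_space ^ 'n"
  assumes "\<And>i. ess_bounded M (\<lambda>x. f x $ i)"
  shows "ess_bounded M f"
proof -
  obtain B where "\<And>i. AE x in M. norm (f x $ i) \<le> B i"
    using assms unfolding ess_bounded_def by metis
  then have "AE x in M. \<forall>i. norm (f x $ i) \<le> B i"
    by (simp add: AE_all_countable)
  then have "AE x in M. norm (f x) \<le> (\<Sum>i\<in>UNIV. B i)"
  proof eventually_elim
    case (elim x)
    have "norm (f x) \<le> (\<Sum>i\<in>UNIV. norm (f x $ i))"
      unfolding norm_vec_def by (rule L2_set_le_sum) simp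
    also have "\<dots> \<le> (\<Sum>i\<in>UNIV. B i)" using elim by (intro sum_mono) simp
    finally show ?case .
  qed
  moreover have "f \<in> borel_measurable M"
  proof (subst borel_measurable_euclidean_space, rule ballI)
    fix b :: "'b ^ 'n" assume "b \<in> Basis"
    then obtain i c where b: "b = axis i c" by (auto simp: Basis_vec_def)
    have "(\<lambda>x. f x $ i \<bullet> c) \<in> borel_measurable M"
      using assms[of i] unfolding ess_bounded_def by auto
    then show "(\<lambda>x. f x \<bullet> b) \<in> borel_measurable M" by (simp add: b inner_axis)
  qed
  ultimately show ?thesis unfolding ess_bounded_def by blast
qed

lemma ess_bounded_matrix_vector:
  fixes A :: "'a \<Rightarrow> real^'n^'m"
  assumes "ess_bounded M A" "ess_bounded M v"
  shows "ess_bounded M (\<lambda>x. A x *v v x)"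
  by (intro ess_bounded_vec)
     (simp add: matrix_vector_mult_def, intro ess_bounded_sum ess_bounded_mult ess_bounded_nth assms)

lemma ess_bounded_transpose:
  fixes A :: "'a \<Rightarrow> real^'n^'m"
  assumes "ess_bounded M A"
  shows "ess_bounded M (\<lambda>x. transpose (A x))"
  by (intro ess_bounded_vec) (simp add: transpose_def, intro ess_bounded_nth assms)

lemma ess_bounded_trace:
  fixes A :: "'a \<Rightarrow> real^'n^'n"
  assumes "ess_bounded M A"
  shows "ess_bounded M (\<lambda>x. trace (A x))"
  unfolding trace_def by (intro ess_bounded_sum ess_bounded_nth assms)

lemma ess_bounded_matrix_matrix:
  fixes A :: "'a \<Rightarrow> real^'n^'m" and B :: "'a \<Rightarrow> real^'k^'n"
  assumes "ess_bounded M A" "ess_bounded M B"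
  shows "ess_bounded M (\<lambda>x. A x ** B x)"
  by (intro ess_bounded_vec)
     (simp add: matrix_matrix_mult_def, intro ess_bounded_sum ess_bounded_mult ess_bounded_nth assms)

lemma ess_bounded_integrable:
  fixes f :: "'a \<Rightarrow> real"
  assumes "finite_measure M" "ess_bounded M f"
  shows "integrable M f"
  using assms finite_measure.integrable_const_bound unfolding ess_bounded_def by blast

lemma ess_bounded_cong:
  assumes "\<And>x. x \<in> space M \<Longrightarrow> f x = g x"
  shows "ess_bounded M f \<longleftrightarrow> ess_bounded M g"
proof -
  have "f \<in> borel_measurable M \<longleftrightarrow> g \<in> borel_measurable M" using assms by (rule measurable_cong)
  moreover have "(AE x in M. norm (f x) \<le> B) \<longleftrightarrow> (AE x in M. norm (g x) \<le> B)" for B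
    using assms by (intro AE_cong) simp
  ultimately show ?thesis unfolding ess_bounded_def by blast
qed

section \<open>Gradients of functions with zero trace\<close>

text \<open>Both functions have the same derivatives at a point of the open set. Hence even the
  arbitrary value that \<open>frechet_derivative\<close> picks at a point of nondifferentiability is
  the same.\<close>

lemma grad_zero_extension:
  fixes u :: "real^'d \<Rightarrow> real^'d"
  assumes "open \<Omega>" "x \<in> \<Omega>"
  shows "grad (zero_extension \<Omega> u) x = grad u x"
proof -
  have "(zero_extension \<Omega> u has_derivative D) (at x) \<longleftrightarrow> (u has_derivative D) (at x)" for D
    using has_derivative_transform_within_open[OF _ assms, of "zero_extension \<Omega> u" D UNIV u]
      has_derivative_transform_within_open[OF _ assms, of u D UNIV "zero_extension \<Omega> u"]
    by (auto simp: zero_extension_def)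
  then show ?thesis by (simp add: jacobian_def frechet_derivative_def)
qed

lemma grad_zero_extension_outside:
  fixes u :: "real^'d \<Rightarrow> real^'d"
  assumes "x \<notin> closure \<Omega>"
  shows "grad (zero_extension \<Omega> u) x = 0"
proof -
  have "(zero_extension \<Omega> u has_derivative (\<lambda>_. 0)) (at x)"
    by (rule zero_extension_has_derivative_outside[OF assms])
  then have "frechet_derivative (zero_extension \<Omega> u) (at x) = (\<lambda>_. 0)"
    using frechet_derivative_at by metis
  then show ?thesis by (simp add: jacobian_def matrix_def vec_eq_iff)
qed

text \<open>This retains what the integral identities use of a finite element function, and no
  longer mentions the mesh.\<close>

definition zero_trace_lipschitz :: "(real^'d) set \<Rightarrow> (real^'d \<Rightarrow> real^'d) \<Rightarrow> bool" where
  "zero_trace_lipschitz \<Omega> u \<longleftrightarrow>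
     (\<exists>M. M-lipschitz_on UNIV (zero_extension \<Omega> u)) \<and>
     (AE x in lebesgue. zero_extension \<Omega> u differentiable (at x))"

lemma velocity_space_zero_trace_lipschitz:
  assumes "open \<Omega>" "simplicial_mesh \<Omega> \<T>" "u \<in> velocity_space \<Omega> \<T>"
  shows "zero_trace_lipschitz \<Omega> u"
proof -
  have "AE x in lebesgue. x \<notin> (\<Union>K\<in>\<T>. frontier K)"
    using skeleton_negligible[OF assms(2)] by (intro AE_not_in) (simp add: negligible_iff_null_sets)
  then have "AE x in lebesgue. zero_extension \<Omega> u differentiable (at x)"
    by eventually_elim (rule zero_extension_differentiable_off_skeleton[OF assms(2,3)])
  then show ?thesis
    using velocity_space_lipschitz[OF assms] by (simp add: zero_trace_lipschitz_def)
qed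

text \<open>A bounded set with null frontier is Jordan measurable, hence the name. The null frontier
  lets the gradient of a zero extension vanish almost everywhere off \<Omega>.\<close>

locale jordan_domain =
  fixes \<Omega> :: "(real^'d) set"
  assumes open_domain: "open \<Omega>" and bounded_domain: "bounded \<Omega>"
    and frontier_null: "negligible (frontier \<Omega>)"
begin

lemma finite_measure_domain: "finite_measure (lebesgue_on \<Omega>)"
  using lmeasurable_open[OF bounded_domain open_domain] by (rule finite_measure_lebesgue_on)

lemma domain_sets [simp]: "\<Omega> \<in> sets lebesgue"
  using open_domain borel_open by auto

lemmas integrable_domain = ess_bounded_integrable[OF finite_measure_domain]

lemma AE_domainI: "AE x in lebesgue. P x \<Longrightarrow> AE x in lebesgue_on \<Omega>. P x"
  by (subst AE_restrict_space_iff, simp, erule eventually_mono, simp)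

context
  fixes u :: "real^'d \<Rightarrow> real^'d"
  assumes u: "zero_trace_lipschitz \<Omega> u"
begin

lemma component_lipschitz: "\<exists>M. M-lipschitz_on UNIV (\<lambda>x. zero_extension \<Omega> u x $ i)"
proof -
  obtain M where "M-lipschitz_on UNIV (zero_extension \<Omega> u)"
    using u unfolding zero_trace_lipschitz_def by blast
  then have "M-lipschitz_on UNIV (\<lambda>x. zero_extension \<Omega> u x $ i)"
    unfolding lipschitz_on_def by (meson dist_vec_nth_le order_trans)
  then show ?thesis ..
qed

lemma component_has_derivative:
  "AE x in lebesgue. ((\<lambda>y. zero_extension \<Omega> u y $ i) has_derivative
     (\<lambda>h. (grad (zero_extension \<Omega> u) x *v h) $ i)) (at x)"
proof -
  have "AE x in lebesgue. zero_extension \<Omega> u differentiable (at x)"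
    using u unfolding zero_trace_lipschitz_def by blast
  then show ?thesis
  proof eventually_elim
    case (elim x)
    then have "(zero_extension \<Omega> u has_derivative (\<lambda>h. grad (zero_extension \<Omega> u) x *v h)) (at x)"
      by (rule jacobian_works[THEN iffD1])
    then show ?case
      by (rule bounded_linear.has_derivative[OF bounded_linear_vec_nth])
  qed
qed

lemma grad_extension_measurable:
  "(\<lambda>x. grad (zero_extension \<Omega> u) x $ i $ j) \<in> borel_measurable lebesgue"
proof -
  have "continuous_on UNIV (\<lambda>x. zero_extension \<Omega> u x $ i)"
    using component_lipschitz lipschitz_on_continuous_on by blast
  from AE_derivative_measurable[OF this component_has_derivative, of "axis j 1"] show ?thesis
    by (simp add: matrix_vector_mult_basis column_def)
qed

lemma grad_extension_outside: "AE x in lebesgue. x \<notin> \<Omega> \<longrightarrow> grad (zero_extension \<Omega> u) x = 0"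
proof -
  have "AE x in lebesgue. x \<notin> frontier \<Omega>"
    using frontier_null by (intro AE_not_in) (simp add: negligible_iff_null_sets)
  then show ?thesis
    by eventually_elim (use closure_Un_frontier[of \<Omega>] grad_zero_extension_outside in blast)
qed

text \<open>An entry of the gradient is the derivative of a component along an axis, so the
  Lipschitz constant of that component bounds it wherever the derivative exists.\<close>

lemma ess_bounded_grad: "ess_bounded (lebesgue_on \<Omega>) (grad u)"
proof (intro ess_bounded_vec)
  fix i j
  obtain M where M: "M-lipschitz_on UNIV (\<lambda>x. zero_extension \<Omega> u x $ i)"
    using component_lipschitz by blast
  have "AE x in lebesgue. norm (grad (zero_extension \<Omega> u) x $ i $ j) \<le> M"
    using component_has_derivative[of i]
  proof eventually_elim
    case (elim x)
    from lipschitz_derivative_bound[OF M this, of "axis j 1"] show ?case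
      by (simp add: matrix_vector_mult_basis column_def norm_axis_1)
  qed
  then have "ess_bounded (lebesgue_on \<Omega>) (\<lambda>x. grad (zero_extension \<Omega> u) x $ i $ j)"
    unfolding ess_bounded_def
    using AE_domainI measurable_restrict_space1[OF grad_extension_measurable] by blast
  then show "ess_bounded (lebesgue_on \<Omega>) (\<lambda>x. grad u x $ i $ j)"
    by (rule ess_bounded_cong[THEN iffD1, rotated]) (simp add: grad_zero_extension[OF open_domain])
qed

lemma ess_bounded_trace_lipschitz: "ess_bounded (lebesgue_on \<Omega>) u"
proof -
  obtain M where M: "M-lipschitz_on UNIV (zero_extension \<Omega> u)"
    using u unfolding zero_trace_lipschitz_def by blast
  have cont: "continuous_on UNIV (zero_extension \<Omega> u)"
    using M by (rule lipschitz_on_continuous_on)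
  have "bounded (zero_extension \<Omega> u ` closure \<Omega>)"
    using bounded_domain by (intro compact_imp_bounded compact_continuous_image continuous_on_subset[OF cont]) auto
  then obtain B where B: "\<And>x. x \<in> \<Omega> \<Longrightarrow> norm (zero_extension \<Omega> u x) \<le> B"
    unfolding bounded_iff using closure_subset by blast
  have "zero_extension \<Omega> u \<in> borel_measurable (lebesgue_on \<Omega>)"
    using cont by (intro measurable_restrict_space1 measurable_completion) (simp add: borel_measurable_continuous_onI)
  moreover have "AE x in lebesgue_on \<Omega>. norm (zero_extension \<Omega> u x) \<le> B"
    using B by (intro AE_I2) simp
  ultimately have "ess_bounded (lebesgue_on \<Omega>) (zero_extension \<Omega> u)"
    unfolding ess_bounded_def by blast
  then show ?thesis
    by (rule ess_bounded_cong[THEN iffD1, rotated]) (simp add: zero_extension_def)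
qed

text \<open>The \<open>2 \<times> 2\<close> minors of a gradient are null Lagrangians. The swap of
  derivatives is applied to two components of the extension in the directions of two axes.\<close>

lemma integral_grad_minor:
  "(\<integral>x. grad u x $ i $ k * grad u x $ j $ l \<partial>lebesgue_on \<Omega>)
 = (\<integral>x. grad u x $ i $ l * grad u x $ j $ k \<partial>lebesgue_on \<Omega>)"
proof -
  let ?A = "grad (zero_extension \<Omega> u)"
  \<comment> \<open>The passage to the whole space costs nothing, since the gradient of the
    extension is zero almost everywhere off \<Omega>.\<close>
  have ext: "(\<integral>x. grad u x $ i $ k * grad u x $ j $ l \<partial>lebesgue_on \<Omega>) = (\<integral>x. ?A x $ i $ k * ?A x $ j $ l \<partial>lebesgue)" for k l
  proof -
    have "(\<integral>x. grad u x $ i $ k * grad u x $ j $ l \<partial>lebesgue_on \<Omega>) = (\<integral>x. ?A x $ i $ k * ?A x $ j $ l \<partial>lebesgue_on \<Omega>)"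
      by (intro Bochner_Integration.integral_cong) (simp_all add: grad_zero_extension[OF open_domain])
    also have "\<dots> = (\<integral>x. indicator \<Omega> x *\<^sub>R (?A x $ i $ k * ?A x $ j $ l) \<partial>lebesgue)"
      by (rule integral_restrict_space) simp
    also have "\<dots> = (\<integral>x. ?A x $ i $ k * ?A x $ j $ l \<partial>lebesgue)"
    proof (rule integral_cong_AE)
      show "AE x in lebesgue. indicator \<Omega> x *\<^sub>R (?A x $ i $ k * ?A x $ j $ l) = ?A x $ i $ k * ?A x $ j $ l"
        using grad_extension_outside by eventually_elim (simp split: split_indicator)
    qed (auto intro!: borel_measurable_times borel_measurable_scaleR borel_measurable_indicator grad_extension_measurable)
    finally show ?thesis .
  qed
  obtain L M where "L-lipschitz_on UNIV (\<lambda>x. zero_extension \<Omega> u x $ i)" "M-lipschitz_on UNIV (\<lambda>x. zero_extension \<Omega> u x $ j)"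
    using component_lipschitz by metis
  moreover obtain r where "\<And>x. x \<in> \<Omega> \<Longrightarrow> norm x \<le> r"
    using bounded_domain unfolding bounded_iff by blast
  then have "zero_extension \<Omega> u x $ i = 0" if "r < norm x" for x
    using that by (force simp: zero_extension_def)
  ultimately have "(\<integral>x. (?A x *v axis k 1) $ i * (?A x *v axis l 1) $ j \<partial>lebesgue)
                 = (\<integral>x. (?A x *v axis l 1) $ i * (?A x *v axis k 1) $ j \<partial>lebesgue)"
    by (rule lipschitz_integral_derivative_swap[OF _ _ _ component_has_derivative component_has_derivative])
  then show ?thesis
    by (simp add: ext matrix_vector_mult_basis column_def)
qed

text \<open>Both sides expand into double sums whose terms differ by the principal minors in rows
  and columns \<open>i\<close>, \<open>j\<close>.\<close>

lemma integral_trace_square: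
  "(\<integral>x. (trace (grad u x))\<^sup>2 \<partial>lebesgue_on \<Omega>) = (\<integral>x. trace (grad u x ** grad u x) \<partial>lebesgue_on \<Omega>)"
proof -
  have int: "integrable (lebesgue_on \<Omega>) (\<lambda>x. grad u x $ i $ k * grad u x $ j $ l)" for i j k l
    by (intro integrable_domain ess_bounded_mult ess_bounded_nth ess_bounded_grad)
  have "(\<integral>x. (trace (grad u x))\<^sup>2 \<partial>lebesgue_on \<Omega>)
      = (\<Sum>i\<in>UNIV. \<Sum>j\<in>UNIV. \<integral>x. grad u x $ i $ i * grad u x $ j $ j \<partial>lebesgue_on \<Omega>)"
    using int by (simp add: trace_def power2_eq_square sum_product)
  also have "\<dots> = (\<Sum>i\<in>UNIV. \<Sum>j\<in>UNIV. \<integral>x. grad u x $ i $ j * grad u x $ j $ i \<partial>lebesgue_on \<Omega>)"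
    by (intro sum.cong refl integral_grad_minor)
  also have "\<dots> = (\<integral>x. trace (grad u x ** grad u x) \<partial>lebesgue_on \<Omega>)"
    using int by (simp add: trace_def matrix_matrix_mult_def)
  finally show ?thesis .
qed

end

end

section \<open>Coercivity of the rotational form\<close>

lemma L2_norm_square: "(L2_norm \<Omega> f)\<^sup>2 = L2_inner \<Omega> f f"
  unfolding L2_norm_def L2_inner_def
  by (rule real_sqrt_pow2, rule Bochner_Integration.integral_nonneg, rule inner_ge_zero)

lemma L2_inner_commute: "L2_inner \<Omega> f g = L2_inner \<Omega> g f"
  unfolding L2_inner_def by (intro Bochner_Integration.integral_cong refl inner_commute)

lemma norm_matrix_vector_le:
  fixes A :: "real^'n^'m"
  shows "norm (A *v w) \<le> norm A * norm w"
proof -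
  have "norm (A *v w) = L2_set (\<lambda>i. A $ i \<bullet> w) UNIV"
    by (simp add: norm_vec_def matrix_vector_mul_component) (simp add: L2_set_def)
  also have "\<dots> \<le> L2_set (\<lambda>i. norm (A $ i) * norm w) UNIV"
    unfolding L2_set_def
    by (intro real_sqrt_le_mono sum_mono abs_le_square_iff[THEN iffD1]) (simp add: Cauchy_Schwarz_ineq2)
  also have "\<dots> = norm A * norm w"
    by (simp add: norm_vec_def[of A] L2_set_left_distrib)
  finally show ?thesis .
qed

text \<open>By duality \<open>norm (transpose A *v v)\<close> squared is
  \<open>v \<bullet> (A *v (transpose A *v v))\<close>, which reduces the claim to the bound for
  \<open>A\<close> itself. The matrix norm here is the Frobenius norm.\<close>

lemma norm_transpose_matrix_vector_le:
  fixes A :: "real^'n^'m"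
  shows "norm (transpose A *v v) \<le> norm A * norm v"
proof (cases "transpose A *v v = 0")
  case False
  let ?w = "transpose A *v v"
  have "norm ?w * norm ?w = v \<bullet> (A *v ?w)"
    using dot_lmul_matrix[of v A ?w] by (simp flip: power2_eq_square power2_norm_eq_inner)
  also have "\<dots> \<le> norm v * (norm A * norm ?w)"
    by (rule order_trans[OF norm_cauchy_schwarz mult_left_mono[OF norm_matrix_vector_le norm_ge_zero]])
  finally show ?thesis using False by (simp add: mult_ac)
qed simp

context jordan_domain
begin

text \<open>The densities of squared curl and squared divergence are nonnegative, so
  \<open>a\<close> can be replaced by its lower bound \<open>m\<close> pointwise. Only then is the
  unweighted identity used by which their integrals add up to that of the squared gradient. Stating
  \<open>curl\<close> through its square treats both dimensions together.\<close>

lemma rotational_form_coercive: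
  fixes curl :: "(real^'d \<Rightarrow> real^'d) \<Rightarrow> real^'d \<Rightarrow> 'c::real_inner"
  assumes u: "zero_trace_lipschitz \<Omega> u"
    and curl: "\<And>x. curl u x \<bullet> curl u x = grad u x \<bullet> grad u x - trace (grad u x ** grad u x)"
    and a: "ess_bounded (lebesgue_on \<Omega>) a" "AE x in lebesgue_on \<Omega>. m \<le> a x" "0 \<le> m"
    and "\<gamma> > 0"
  shows "m * min \<gamma> 1 * (L2_norm \<Omega> (grad u))\<^sup>2
    \<le> L2_inner \<Omega> (\<lambda>x. a x *\<^sub>R curl u x) (curl u) + \<gamma> * L2_inner \<Omega> (\<lambda>x. a x * div_op u x) (div_op u)"
proof -
  let ?M = "lebesgue_on \<Omega>"
  let ?c = "\<lambda>x. grad u x \<bullet> grad u x - trace (grad u x ** grad u x)" and ?d = "\<lambda>x. (trace (grad u x))\<^sup>2"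
  note A = ess_bounded_grad[OF u]
  have c: "ess_bounded ?M ?c"
    by (intro ess_bounded_diff ess_bounded_inner ess_bounded_trace ess_bounded_matrix_matrix A)
  have d: "ess_bounded ?M ?d"
    unfolding power2_eq_square by (intro ess_bounded_mult ess_bounded_trace A)
  \<comment> \<open>The sign is not visible in the matrix expression; it comes from reading it as a
    squared curl.\<close>
  have c0: "0 \<le> ?c x" for x using curl[of x] inner_ge_zero[of "curl u x"] by linarith
  have weighted: "m * integral\<^sup>L ?M f \<le> (\<integral>x. a x * f x \<partial>?M)" if f: "ess_bounded ?M f" "\<And>x. 0 \<le> f x" for f
  proof -
    have "(\<integral>x. m * f x \<partial>?M) \<le> (\<integral>x. a x * f x \<partial>?M)"
    proof (rule integral_mono_AE)
      show "AE x in ?M. m * f x \<le> a x * f x"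
        using a(2) by eventually_elim (use f(2) in \<open>simp add: mult_right_mono\<close>)
    qed (intro integrable_domain ess_bounded_mult ess_bounded_const a f)+
    then show ?thesis by simp
  qed
  have "(L2_norm \<Omega> (grad u))\<^sup>2 = (\<integral>x. grad u x \<bullet> grad u x \<partial>?M)"
    by (simp add: L2_norm_square L2_inner_def)
  also have "\<dots> = integral\<^sup>L ?M ?c + integral\<^sup>L ?M ?d"
  proof -
    have "integrable ?M (\<lambda>x. grad u x \<bullet> grad u x)" "integrable ?M (\<lambda>x. trace (grad u x ** grad u x))"
      by (intro integrable_domain ess_bounded_inner ess_bounded_trace ess_bounded_matrix_matrix A)+
    then show ?thesis unfolding integral_trace_square[OF u] by simp
  qed
  finally have "m * min \<gamma> 1 * (L2_norm \<Omega> (grad u))\<^sup>2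
      = min \<gamma> 1 * (m * integral\<^sup>L ?M ?c) + min \<gamma> 1 * (m * integral\<^sup>L ?M ?d)"
    by (simp add: algebra_simps)
  also have "\<dots> \<le> 1 * (m * integral\<^sup>L ?M ?c) + \<gamma> * (m * integral\<^sup>L ?M ?d)"
  proof (intro add_mono mult_right_mono mult_nonneg_nonneg \<open>0 \<le> m\<close>)
    show "0 \<le> integral\<^sup>L ?M ?c" "0 \<le> integral\<^sup>L ?M ?d"
      by (rule Bochner_Integration.integral_nonneg, rule c0)
         (rule Bochner_Integration.integral_nonneg, rule zero_le_power2)
  qed simp_all
  also have "\<dots> \<le> (\<integral>x. a x * ?c x \<partial>?M) + \<gamma> * (\<integral>x. a x * ?d x \<partial>?M)"
    unfolding mult_1
    by (intro add_mono mult_left_mono weighted[OF c c0] weighted[OF d zero_le_power2] less_imp_le[OF \<open>\<gamma> > 0\<close>])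
  also have "\<dots> = L2_inner \<Omega> (\<lambda>x. a x *\<^sub>R curl u x) (curl u) + \<gamma> * L2_inner \<Omega> (\<lambda>x. a x * div_op u x) (div_op u)"
    by (simp add: L2_inner_def curl div_op_def power2_eq_square mult.assoc)
  finally show ?thesis .
qed

end

section \<open>BDF2 energy inequality\<close>

text \<open>Young's inequality, from the square of \<open>\<kappa> * norm v - 4 * h * m\<close>. The
  weight \<open>h\<close> stays free because two different weights are needed.\<close>

lemma inner_le_young:
  fixes f v :: "'a::real_inner"
  assumes "h > 0" "norm f \<le> \<kappa> * m" "0 \<le> \<kappa>" 
  shows "8 * (f \<bullet> v) \<le> \<kappa>\<^sup>2 / h * (v \<bullet> v) + 16 * h * m\<^sup>2"
proof -
  have "0 \<le> (\<kappa> * norm v - 4 * h * m)\<^sup>2 / h" using assms by simp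
  also have "\<dots> = \<kappa>\<^sup>2 / h * (v \<bullet> v) + 16 * h * m\<^sup>2 - 8 * (\<kappa> * m * norm v)"
    using assms(1) unfolding power2_norm_eq_inner[symmetric] by (simp add: field_simps power2_eq_square)
  finally have "8 * (\<kappa> * m * norm v) \<le> \<kappa>\<^sup>2 / h * (v \<bullet> v) + 16 * h * m\<^sup>2" by simp
  moreover have "f \<bullet> v \<le> \<kappa> * m * norm v"
    using norm_cauchy_schwarz[of f v] mult_right_mono[OF assms(2) norm_ge_zero[of v]] by linarith
  ultimately show ?thesis by linarith
qed

text \<open>The test function \<open>a\<close> is split as the extrapolation \<open>2 b - c\<close> plus the second difference
  \<open>a - 2 b + c\<close>. The first part feeds the Gronwall argument, the second one is absorbed by the
  numerical dissipation of BDF2; neither needs a restriction on the step size.\<close>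

lemma bdf2_pointwise:
  fixes a b c X Y :: "'a::real_inner"
  assumes \<tau>: "0 < \<tau>" and h: "0 < h" and \<kappa>: "0 \<le> \<kappa>"
    and X: "norm X \<le> \<kappa> * g" and Y: "norm Y \<le> \<kappa> * g'"
  shows "8 * \<tau> * ((2 *\<^sub>R X - Y) \<bullet> a) - 2 * ((3 *\<^sub>R a - 4 *\<^sub>R b + c) \<bullet> a)
    \<le> b \<bullet> b + (1 + \<tau> * (\<kappa>\<^sup>2 / h)) * ((2 *\<^sub>R b - c) \<bullet> (2 *\<^sub>R b - c))
      - a \<bullet> a - (2 *\<^sub>R a - b) \<bullet> (2 *\<^sub>R a - b)
      + 16 * h * \<tau> * (1 + \<tau> * (\<kappa>\<^sup>2 / h)) * (8 * g\<^sup>2 + 2 * g'\<^sup>2)"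
proof -
  define m where "m = 2 * g + g'"
  define s where "s = 2 *\<^sub>R b - c"
  define \<delta> where "\<delta> = a - 2 *\<^sub>R b + c"
  define f where "f = 2 *\<^sub>R X - Y"
  have f: "norm f \<le> \<kappa> * m"
    unfolding f_def m_def using norm_triangle_ineq4[of "2 *\<^sub>R X" Y] X Y by (simp add: algebra_simps)
  have m: "m\<^sup>2 \<le> 8 * g\<^sup>2 + 2 * g'\<^sup>2"
    using zero_le_power2[of "2 * g - g'"] by (simp add: m_def power2_eq_square algebra_simps)
  have "8 * \<tau> * (f \<bullet> a) = 8 * \<tau> * (f \<bullet> s) + 8 * \<tau> * (f \<bullet> \<delta>)" by (simp add: s_def \<delta>_def algebra_simps)
  moreover have "8 * \<tau> * (f \<bullet> s) \<le> \<tau> * (\<kappa>\<^sup>2 / h) * (s \<bullet> s) + 16 * h * \<tau> * m\<^sup>2"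
    using mult_left_mono[OF inner_le_young[OF h f \<kappa>, of s], of \<tau>] \<tau> by (simp add: algebra_simps)
  moreover have "8 * \<tau> * (f \<bullet> \<delta>) \<le> \<delta> \<bullet> \<delta> + 16 * \<tau>\<^sup>2 * \<kappa>\<^sup>2 * m\<^sup>2"
  proof (cases "\<kappa> = 0")
    case True
    then show ?thesis using f by simp
  next
    case False
    \<comment> \<open>The weight \<open>\<tau> * \<kappa>\<^sup>2\<close> makes the coefficient of
      \<open>\<delta> \<bullet> \<delta>\<close> exactly 1 after multiplication by \<tau>, which is
      all that the dissipation can absorb. A positive weight requires the separate case of vanishing
      \<kappa>.\<close>
    with \<kappa> \<tau> have "0 < \<tau> * \<kappa>\<^sup>2" by simp
    from mult_left_mono[OF inner_le_young[OF this f \<kappa>, of \<delta>], of \<tau>] show ?thesis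
      using \<tau> False by (simp add: power2_eq_square algebra_simps)
  qed
  \<comment> \<open>The energy identity of BDF2: a telescoping difference of energies plus the
    dissipation \<open>\<delta> \<bullet> \<delta>\<close>.\<close>
  moreover have "2 * ((3 *\<^sub>R a - 4 *\<^sub>R b + c) \<bullet> a)
      = a \<bullet> a + (2 *\<^sub>R a - b) \<bullet> (2 *\<^sub>R a - b) - b \<bullet> b - s \<bullet> s + \<delta> \<bullet> \<delta>"
    by (simp add: s_def \<delta>_def inner_commute algebra_simps)
  \<comment> \<open>The remainders of the two Young inequalities combine into the same growth factor
    that multiplies \<open>s \<bullet> s\<close>, so large steps are harmless.\<close>
  moreover have "16 * h * \<tau> * (1 + \<tau> * (\<kappa>\<^sup>2 / h)) * m\<^sup>2 = 16 * h * \<tau> * m\<^sup>2 + 16 * \<tau>\<^sup>2 * \<kappa>\<^sup>2 * m\<^sup>2"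
    using h by (simp add: field_simps power2_eq_square)
  moreover have "16 * h * \<tau> * (1 + \<tau> * (\<kappa>\<^sup>2 / h)) * m\<^sup>2
      \<le> 16 * h * \<tau> * (1 + \<tau> * (\<kappa>\<^sup>2 / h)) * (8 * g\<^sup>2 + 2 * g'\<^sup>2)"
    using h \<tau> by (intro mult_left_mono m) auto
  moreover have "(1 + \<tau> * (\<kappa>\<^sup>2 / h)) * (s \<bullet> s) = s \<bullet> s + \<tau> * (\<kappa>\<^sup>2 / h) * (s \<bullet> s)"
    by (simp add: algebra_simps)
  ultimately show ?thesis
    unfolding f_def[symmetric] s_def[symmetric] by linarith
qed

text \<open>The term \<open>G (n - 1)\<close> is carried inside the functional
  \<open>E n + 32 * (5 * G n + G (n - 1))\<close>. It uses 160 of the \<beta> units of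
  \<open>G (n + 1)\<close>; the rest accumulates in the sum, which is empty at the start level
  1.\<close>

lemma gronwall_two_step:
  fixes E G :: "nat \<Rightarrow> real"
  assumes N: "1 \<le> N" and a: "0 \<le> a" and G: "\<And>n. 0 \<le> G n" and E: "\<And>n. 0 \<le> E n"
    and \<beta>: "160 \<le> \<beta>"
    and step: "\<And>n. n \<in> {1..<N} \<Longrightarrow>
      E (n + 1) + \<beta> * G (n + 1) \<le> (1 + a) * E n + (1 + a) * (128 * G n + 32 * G (n - 1))"
  shows "E N + 32 * (5 * G N + G (N - 1)) + (\<beta> - 160) * (\<Sum>n=2..N. G n)
    \<le> (1 + a) ^ (N - 1) * (E 1 + 32 * (5 * G 1 + G 0))"
  using N step
proof (induction N rule: dec_induct)
  case base
  then show ?case by simp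
next
  case (step n)
  let ?F = "\<lambda>n. E n + 32 * (5 * G n + G (n - 1))" and ?S = "(\<beta> - 160) * (\<Sum>n=2..n. G n)"
  have S: "0 \<le> ?S" using \<beta> G by (simp add: sum_nonneg)
  \<comment> \<open>The functional at level \<open>Suc n\<close> contains \<open>32 * G n\<close>.
    It is enlarged to \<open>(1 + a) * 32 * G n\<close> and joins the 128 units to give the required
    \<open>160 = 32 * 5\<close>.\<close>
  have Gn: "0 \<le> a * G n" using a G by simp
  have "E (n + 1) + \<beta> * G (n + 1) \<le> (1 + a) * E n + (1 + a) * (128 * G n + 32 * G (n - 1))"
    using step by auto
  then have "?F (Suc n) + (\<beta> - 160) * G (Suc n) \<le> (1 + a) * ?F n"
    using Gn by (simp add: algebra_simps)
  \<comment> \<open>The accumulated sum is amplified as well, so that functional and sum together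
    satisfy one geometric recursion.\<close>
  moreover have "?S \<le> (1 + a) * ?S" using mult_right_mono[OF _ S, of 1 "1 + a"] a by simp
  moreover have "(\<beta> - 160) * (\<Sum>n=2..Suc n. G n) = ?S + (\<beta> - 160) * G (Suc n)"
    using step.hyps by (simp add: algebra_simps)
  moreover have "(1 + a) * (?F n + ?S) = (1 + a) * ?F n + (1 + a) * ?S"
    by (rule distrib_left)
  ultimately have "?F (Suc n) + (\<beta> - 160) * (\<Sum>n=2..Suc n. G n) \<le> (1 + a) * (?F n + ?S)"
    by linarith
  also have "\<dots> \<le> (1 + a) * ((1 + a) ^ (n - 1) * ?F 1)"
    using step a by (intro mult_left_mono) auto
  also have "\<dots> = (1 + a) ^ n * ?F 1"
    using step.hyps by (cases n) auto
  finally show ?case by simp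
qed

section \<open>Stability of the scheme\<close>

lemma W1inf_gradient_ess_bounded:
  assumes "W1inf_gradient \<Omega> f G" "Linf_norm \<Omega> G \<le> ereal \<kappa>"
  shows "ess_bounded (lebesgue_on \<Omega>) G" "AE x in lebesgue_on \<Omega>. norm (G x) \<le> \<kappa>"
proof -
  have "AE x in lebesgue_on \<Omega>. ereal (norm (G x)) \<le> Linf_norm \<Omega> G"
    unfolding Linf_norm_def by (rule esssup_AE)
  then show AE: "AE x in lebesgue_on \<Omega>. norm (G x) \<le> \<kappa>"
    by eventually_elim (use assms(2) order_trans in force)
  then show "ess_bounded (lebesgue_on \<Omega>) G"
    using assms(1) unfolding ess_bounded_def W1inf_gradient_def by blast
qed

lemma ustar_Suc: "n \<ge> 1 \<Longrightarrow> ustar u (n + 1) = (\<lambda>x. 2 *\<^sub>R u n x - u (n - 1) x)"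
  by (auto simp: ustar_def numeral_2_eq_2)

lemma ustar_velocity_space:
  assumes "n \<ge> 1" "u n \<in> velocity_space \<Omega> \<T>" "u (n - 1) \<in> velocity_space \<Omega> \<T>"
  shows "ustar u (n + 1) \<in> velocity_space \<Omega> \<T>"
  unfolding ustar_Suc[OF assms(1)]
  using velocity_space_linear_combination[OF assms(2,3), of 2 "-1"] by simp

context jordan_domain
begin

text \<open>The bounds are those of \<open>f\<close> at the fixed time \<open>t\<close>.
  Measurability is taken from \<open>\<nu> (n + 1)\<close>, which agrees with
  \<open>\<nu>star (n + 1)\<close> on \<Omega>.\<close>

lemma prescribed_viscosity_bounds:
  assumes \<nu>: "prescribed_viscosity \<Omega> T N \<nu>\<^sub>m\<^sub>i\<^sub>n \<nu>\<^sub>m\<^sub>a\<^sub>x \<nu> \<nu>star \<kappa>" and n: "n \<in> {1..<N}" and T: "T > 0"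
    and min: "0 < \<nu>\<^sub>m\<^sub>i\<^sub>n" and meas: "\<nu> (n + 1) \<in> borel_measurable (lebesgue_on \<Omega>)"
  shows "ess_bounded (lebesgue_on \<Omega>) (\<nu>star (n + 1))" "AE x in lebesgue_on \<Omega>. \<nu>\<^sub>m\<^sub>i\<^sub>n \<le> \<nu>star (n + 1) x"
proof -
  obtain f :: "(real^'d) \<times> real \<Rightarrow> real" where
    f: "\<And>t. t \<in> {0..T} \<Longrightarrow> AE x in lebesgue_on \<Omega>. \<nu>\<^sub>m\<^sub>i\<^sub>n \<le> f (x, t) \<and> f (x, t) \<le> \<nu>\<^sub>m\<^sub>a\<^sub>x"
    and \<nu>f: "\<And>k x. k \<le> N \<Longrightarrow> x \<in> \<Omega> \<Longrightarrow> \<nu> k x = f (x, real k * (T / real N))"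
    and sf: "\<And>k x. k \<in> {1..<N} \<Longrightarrow> x \<in> \<Omega> \<Longrightarrow> \<nu>star (k + 1) x = f (x, real (k + 1) * (T / real N))"
    using \<nu> unfolding prescribed_viscosity_def by blast
  define t where "t = real (n + 1) * (T / real N)"
  have "real (n + 1) * T \<le> real N * T" using n T by (intro mult_right_mono) auto
  then have "t \<in> {0..T}"
    using n T by (simp add: t_def field_simps)
  from f[OF this] have f: "AE x in lebesgue_on \<Omega>. \<nu>\<^sub>m\<^sub>i\<^sub>n \<le> f (x, t) \<and> f (x, t) \<le> \<nu>\<^sub>m\<^sub>a\<^sub>x" .
  have star: "\<nu>star (n + 1) x = f (x, t)" if "x \<in> \<Omega>" for x using sf[OF n that] by (simp add: t_def)
  have "AE x in lebesgue_on \<Omega>. \<nu>star (n + 1) x = f (x, t)"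
    using star by (intro AE_I2) simp
  with f have b: "AE x in lebesgue_on \<Omega>. \<nu>\<^sub>m\<^sub>i\<^sub>n \<le> \<nu>star (n + 1) x \<and> \<nu>star (n + 1) x \<le> \<nu>\<^sub>m\<^sub>a\<^sub>x"
    by eventually_elim simp
  then show "AE x in lebesgue_on \<Omega>. \<nu>\<^sub>m\<^sub>i\<^sub>n \<le> \<nu>star (n + 1) x" by eventually_elim simp
  have "\<nu> (n + 1) x = \<nu>star (n + 1) x" if "x \<in> \<Omega>" for x
    using \<nu>f[of "n + 1" x] star[OF that] that n by (simp add: t_def)
  then have "\<nu>star (n + 1) \<in> borel_measurable (lebesgue_on \<Omega>)"
    using meas by (subst measurable_cong[of _ _ "\<nu> (n + 1)"]) simp_all
  moreover have "AE x in lebesgue_on \<Omega>. norm (\<nu>star (n + 1) x) \<le> \<nu>\<^sub>m\<^sub>a\<^sub>x"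
    using b by eventually_elim (use min in simp)
  ultimately show "ess_bounded (lebesgue_on \<Omega>) (\<nu>star (n + 1))"
    unfolding ess_bounded_def by blast
qed

text \<open>The extrapolated velocity has a measurable gradient, hence a measurable shear rate. Its
  values are nonnegative, so it composes with \<eta>, which is Borel on the half line.\<close>

lemma rheological_viscosity_bounds:
  assumes \<nu>: "rheological_viscosity \<Omega> N \<nu>\<^sub>m\<^sub>i\<^sub>n \<nu>\<^sub>m\<^sub>a\<^sub>x u \<nu> \<nu>star d\<nu> \<kappa>" and n: "n \<in> {1..<N}"
    and min: "0 < \<nu>\<^sub>m\<^sub>i\<^sub>n" and u: "zero_trace_lipschitz \<Omega> (ustar u (n + 1))"
  shows "ess_bounded (lebesgue_on \<Omega>) (\<nu>star (n + 1))" "AE x in lebesgue_on \<Omega>. \<nu>\<^sub>m\<^sub>i\<^sub>n \<le> \<nu>star (n + 1) x"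
proof -
  let ?v = "ustar u (n + 1)"
  obtain \<eta> :: "real \<Rightarrow> real" where \<eta>: "\<eta> \<in> borel_measurable (restrict_space borel {0..})"
    and b: "\<And>s. s \<ge> 0 \<Longrightarrow> \<nu>\<^sub>m\<^sub>i\<^sub>n \<le> \<eta> s \<and> \<eta> s \<le> \<nu>\<^sub>m\<^sub>a\<^sub>x"
    and star: "\<And>x. x \<in> \<Omega> \<Longrightarrow> \<nu>star (n + 1) x = \<eta> (shear_rate ?v x)"
    using \<nu> n unfolding rheological_viscosity_def by blast
  have s0: "0 \<le> shear_rate ?v x" for x unfolding shear_rate_def by simp
  show "AE x in lebesgue_on \<Omega>. \<nu>\<^sub>m\<^sub>i\<^sub>n \<le> \<nu>star (n + 1) x"
    using star b s0 by (intro AE_I2) simp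
  have "ess_bounded (lebesgue_on \<Omega>) (\<lambda>x. 2 * (sym_grad ?v x \<bullet> sym_grad ?v x))"
    unfolding sym_grad_def
    by (intro ess_bounded_mult ess_bounded_const ess_bounded_inner ess_bounded_scaleR ess_bounded_add
        ess_bounded_transpose ess_bounded_grad u)
  then have "shear_rate ?v \<in> borel_measurable (lebesgue_on \<Omega>)"
    unfolding shear_rate_def ess_bounded_def
    by (intro measurable_compose[OF _ borel_measurable_sqrt]) blast
  then have "shear_rate ?v \<in> measurable (lebesgue_on \<Omega>) (restrict_space borel {0..})"
    using s0 by (intro measurable_restrict_space2) auto
  from measurable_compose[OF this \<eta>] have "\<nu>star (n + 1) \<in> borel_measurable (lebesgue_on \<Omega>)"
    using star by (subst measurable_cong[of _ _ "\<lambda>x. \<eta> (shear_rate ?v x)"]) simp_all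
  moreover have "\<bar>\<nu>star (n + 1) x\<bar> \<le> \<nu>\<^sub>m\<^sub>a\<^sub>x" if "x \<in> \<Omega>" for x
    using b[OF s0[of x]] star[OF that] min by simp
  then have "AE x in lebesgue_on \<Omega>. norm (\<nu>star (n + 1) x) \<le> \<nu>\<^sub>m\<^sub>a\<^sub>x"
    by (intro AE_I2) simp
  ultimately show "ess_bounded (lebesgue_on \<Omega>) (\<nu>star (n + 1))"
    unfolding ess_bounded_def by blast
qed

section \<open>The energy inequality for one time step\<close>

lemma L2_inner_add_left:
  fixes f g w :: "real^'d \<Rightarrow> 'c::euclidean_space"
  assumes "ess_bounded (lebesgue_on \<Omega>) f" "ess_bounded (lebesgue_on \<Omega>) g" "ess_bounded (lebesgue_on \<Omega>) w"
  shows "L2_inner \<Omega> (\<lambda>x. f x + g x) w = L2_inner \<Omega> f w + L2_inner \<Omega> g w"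
  unfolding L2_inner_def inner_add_left
  by (intro Bochner_Integration.integral_add integrable_domain ess_bounded_inner assms)

lemma L2_inner_scaleR_left: "L2_inner \<Omega> (\<lambda>x. c *\<^sub>R f x) w = c * L2_inner \<Omega> f w"
  unfolding L2_inner_def by simp

text \<open>The pointwise inequality is integrated with \<open>norm (A x)\<close> and
  \<open>norm (B x)\<close> in the roles of \<open>g\<close> and \<open>g'\<close>. Later
  \<open>A\<close>, \<open>B\<close> are velocity gradients and \<open>X\<close>, \<open>Y\<close>
  their products with viscosity gradients.\<close>

lemma bdf2_energy:
  fixes a b c X Y :: "real^'d \<Rightarrow> 'c::euclidean_space"
    and A B :: "real^'d \<Rightarrow> 'e::euclidean_space"
  assumes \<tau>: "0 < \<tau>" and h: "0 < h" and \<kappa>: "0 \<le> \<kappa>"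
    and a: "ess_bounded (lebesgue_on \<Omega>) a" and b: "ess_bounded (lebesgue_on \<Omega>) b"
    and c: "ess_bounded (lebesgue_on \<Omega>) c" and X: "ess_bounded (lebesgue_on \<Omega>) X"
    and Y: "ess_bounded (lebesgue_on \<Omega>) Y" and A: "ess_bounded (lebesgue_on \<Omega>) A"
    and B: "ess_bounded (lebesgue_on \<Omega>) B"
    and XA: "AE x in lebesgue_on \<Omega>. norm (X x) \<le> \<kappa> * norm (A x)"
    and YB: "AE x in lebesgue_on \<Omega>. norm (Y x) \<le> \<kappa> * norm (B x)"
  shows "8 * \<tau> * L2_inner \<Omega> (\<lambda>x. 2 *\<^sub>R X x - Y x) a - 2 * L2_inner \<Omega> (\<lambda>x. 3 *\<^sub>R a x - 4 *\<^sub>R b x + c x) a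
    \<le> (L2_norm \<Omega> b)\<^sup>2 + (1 + \<tau> * (\<kappa>\<^sup>2 / h)) * (L2_norm \<Omega> (\<lambda>x. 2 *\<^sub>R b x - c x))\<^sup>2
      - (L2_norm \<Omega> a)\<^sup>2 - (L2_norm \<Omega> (\<lambda>x. 2 *\<^sub>R a x - b x))\<^sup>2
      + 16 * h * \<tau> * (1 + \<tau> * (\<kappa>\<^sup>2 / h)) * (8 * (L2_norm \<Omega> A)\<^sup>2 + 2 * (L2_norm \<Omega> B)\<^sup>2)"
proof -
  let ?M = "lebesgue_on \<Omega>"
  let ?K = "1 + \<tau> * (\<kappa>\<^sup>2 / h)"
  let ?s = "\<lambda>x. 2 *\<^sub>R b x - c x" and ?s' = "\<lambda>x. 2 *\<^sub>R a x - b x"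
  let ?f = "\<lambda>x. 2 *\<^sub>R X x - Y x" and ?g = "\<lambda>x. 3 *\<^sub>R a x - 4 *\<^sub>R b x + c x"
  have int: "integrable ?M (\<lambda>x. ?f x \<bullet> a x)" "integrable ?M (\<lambda>x. ?g x \<bullet> a x)"
    "integrable ?M (\<lambda>x. a x \<bullet> a x)" "integrable ?M (\<lambda>x. b x \<bullet> b x)"
    "integrable ?M (\<lambda>x. ?s x \<bullet> ?s x)" "integrable ?M (\<lambda>x. ?s' x \<bullet> ?s' x)"
    "integrable ?M (\<lambda>x. A x \<bullet> A x)" "integrable ?M (\<lambda>x. B x \<bullet> B x)"
    by (intro integrable_domain ess_bounded_inner ess_bounded_diff ess_bounded_add ess_bounded_scaleR
        ess_bounded_const a b c X Y A B)+
  let ?l = "\<lambda>x. 8 * \<tau> * (?f x \<bullet> a x) - 2 * (?g x \<bullet> a x)"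
  let ?r = "\<lambda>x. b x \<bullet> b x + ?K * (?s x \<bullet> ?s x) - a x \<bullet> a x - ?s' x \<bullet> ?s' x
      + 16 * h * \<tau> * ?K * (8 * (A x \<bullet> A x) + 2 * (B x \<bullet> B x))"
  have "integral\<^sup>L ?M ?l \<le> integral\<^sup>L ?M ?r"
  proof (rule integral_mono_AE)
    show "integrable ?M ?l" "integrable ?M ?r"
      by (intro Bochner_Integration.integrable_add Bochner_Integration.integrable_diff
          integrable_mult_right int)+
    show "AE x in ?M. ?l x \<le> ?r x"
      using XA YB
    proof eventually_elim
      case (elim x)
      from bdf2_pointwise[OF \<tau> h \<kappa> this] show ?case unfolding power2_norm_eq_inner .
    qed
  qed
  moreover have "integral\<^sup>L ?M ?l = 8 * \<tau> * L2_inner \<Omega> ?f a - 2 * L2_inner \<Omega> ?g a"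
    using int(1,2) unfolding L2_inner_def
    by (subst Bochner_Integration.integral_diff) (auto simp only: integral_mult_right_zero integrable_mult_right)
  moreover have "integral\<^sup>L ?M ?r = L2_inner \<Omega> b b + ?K * L2_inner \<Omega> ?s ?s - L2_inner \<Omega> a a - L2_inner \<Omega> ?s' ?s'
      + 16 * h * \<tau> * ?K * (8 * L2_inner \<Omega> A A + 2 * L2_inner \<Omega> B B)"
    using int(3-) unfolding L2_inner_def
    by (simp only: Bochner_Integration.integral_add Bochner_Integration.integral_diff integral_mult_right_zero
        Bochner_Integration.integrable_add Bochner_Integration.integrable_diff integrable_mult_right)
  ultimately show ?thesis unfolding L2_norm_square by linarith
qed

text \<open>Testing with the new velocity and pressure cancels the two pressure terms and removes
  convection. Coercivity and the BDF2 inequality then estimate the rest; \<open>h\<close> is still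
  an arbitrary weight.\<close>

lemma rotational_imex_energy_step:
  fixes curl :: "(real^'d \<Rightarrow> real^'d) \<Rightarrow> real^'d \<Rightarrow> 'c::real_inner"
  assumes curl: "\<And>v x. curl v x \<bullet> curl v x = grad v x \<bullet> grad v x - trace (grad v x ** grad v x)"
    and u: "\<And>k. k \<in> {n - 1, n, n + 1} \<Longrightarrow> zero_trace_lipschitz \<Omega> (u k)"
    and U: "u (n + 1) \<in> velocity_space \<Omega> \<T>" and P: "p (n + 1) \<in> pressure_space \<Omega> \<T>"
    and n: "n \<ge> 1" and \<tau>: "\<tau> > 0" and \<gamma>: "\<gamma> > 0" and h: "h > 0" and m: "m > 0"
    and scheme: "rotational_imex_step curl \<Omega> \<T> \<tau> \<gamma> u p \<nu>star d\<nu> n"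
    and conv: "L2_inner \<Omega> (convection (ustar u (n + 1)) (u (n + 1))) (u (n + 1)) = 0"
    and \<nu>star: "ess_bounded (lebesgue_on \<Omega>) (\<nu>star (n + 1))" "AE x in lebesgue_on \<Omega>. m \<le> \<nu>star (n + 1) x"
    and d\<nu>: "\<And>k. k \<in> {n - 1, n} \<Longrightarrow> ess_bounded (lebesgue_on \<Omega>) (d\<nu> k)"
      "\<And>k. k \<in> {n - 1, n} \<Longrightarrow> AE x in lebesgue_on \<Omega>. norm (d\<nu> k x) \<le> \<kappa>"
  shows "(L2_norm \<Omega> (u (n + 1)))\<^sup>2 + (L2_norm \<Omega> (ustar u (n + 2)))\<^sup>2
      + 4 * \<tau> * (m * min \<gamma> 1 * (L2_norm \<Omega> (grad (u (n + 1))))\<^sup>2)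
    \<le> (L2_norm \<Omega> (u n))\<^sup>2 + (1 + \<tau> * (\<kappa>\<^sup>2 / h)) * (L2_norm \<Omega> (ustar u (n + 1)))\<^sup>2
      + 16 * h * \<tau> * (1 + \<tau> * (\<kappa>\<^sup>2 / h)) * (8 * (L2_norm \<Omega> (grad (u n)))\<^sup>2 + 2 * (L2_norm \<Omega> (grad (u (n - 1))))\<^sup>2)"
proof -
  define a b c where "a = u (n + 1)" and "b = u n" and "c = u (n - 1)"
  define X Y where "X x = transpose (grad b x) *v d\<nu> n x" and "Y x = transpose (grad c x) *v d\<nu> (n - 1) x" for x
  define V where "V = L2_inner \<Omega> (\<lambda>x. \<nu>star (n + 1) x *\<^sub>R curl a x) (curl a)
      + \<gamma> * L2_inner \<Omega> (\<lambda>x. \<nu>star (n + 1) x * div_op a x) (div_op a)"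
  have tr: "zero_trace_lipschitz \<Omega> a" "zero_trace_lipschitz \<Omega> b" "zero_trace_lipschitz \<Omega> c"
    using u by (simp_all add: a_def b_def c_def)
  note ua = ess_bounded_trace_lipschitz[OF tr(1)] and ub = ess_bounded_trace_lipschitz[OF tr(2)]
    and uc = ess_bounded_trace_lipschitz[OF tr(3)]
  note ga = ess_bounded_grad[OF tr(1)] and gb = ess_bounded_grad[OF tr(2)] and gc = ess_bounded_grad[OF tr(3)]
  have s: "ustar u (n + 1) = (\<lambda>x. 2 *\<^sub>R b x - c x)" "ustar u (n + 2) = (\<lambda>x. 2 *\<^sub>R a x - b x)"
    using ustar_Suc[OF n, of u] ustar_Suc[of "n + 1" u] by (simp_all add: a_def b_def c_def)
  have X: "ess_bounded (lebesgue_on \<Omega>) X" and Y: "ess_bounded (lebesgue_on \<Omega>) Y"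
    unfolding X_def Y_def
    by (intro ess_bounded_matrix_vector ess_bounded_transpose gb gc d\<nu>(1), simp)+
  \<comment> \<open>The sign of \<kappa> is left open here, hence the absolute value; \<kappa>
    enters the result only through its square.\<close>
  have le: "norm (transpose G *v v) \<le> \<bar>\<kappa>\<bar> * norm G" if "norm v \<le> \<kappa>" for G :: "real^'d^'d" and v
  proof -
    have "norm v \<le> \<bar>\<kappa>\<bar>" using that by linarith
    from mult_left_mono[OF this norm_ge_zero[of G]] show ?thesis
      using norm_transpose_matrix_vector_le[of G v] by (simp only: mult.commute)
  qed
  have XA: "AE x in lebesgue_on \<Omega>. norm (X x) \<le> \<bar>\<kappa>\<bar> * norm (grad b x)"
    using d\<nu>(2)[of n, OF insertI2[OF singletonI]] unfolding X_def by eventually_elim (rule le)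
  have YB: "AE x in lebesgue_on \<Omega>. norm (Y x) \<le> \<bar>\<kappa>\<bar> * norm (grad c x)"
    using d\<nu>(2)[of "n - 1", OF insertI1] unfolding Y_def by eventually_elim (rule le)
  note energy = bdf2_energy[OF \<tau> h abs_ge_zero ua ub uc X Y gb gc XA YB, unfolded power2_abs]
  have coercive: "m * min \<gamma> 1 * (L2_norm \<Omega> (grad a))\<^sup>2 \<le> V"
    unfolding V_def using m by (intro rotational_form_coercive tr(1) curl \<nu>star \<gamma>) simp
  have cv: "ess_bounded (lebesgue_on \<Omega>) (convection (ustar u (n + 1)) a)"
    unfolding convection_def s
    by (intro ess_bounded_matrix_vector ess_bounded_diff ess_bounded_scaleR ess_bounded_const ga ub uc)
  note scale = ess_bounded_scaleR[OF ess_bounded_const]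
  have bc: "ess_bounded (lebesgue_on \<Omega>) (\<lambda>x. 4 *\<^sub>R b x - c x)"
    and XY: "ess_bounded (lebesgue_on \<Omega>) (\<lambda>x. 2 *\<^sub>R X x - Y x)"
    by (intro ess_bounded_diff scale ub uc X Y)+
  have "L2_inner \<Omega> (\<lambda>x. (3 / (2 * \<tau>)) *\<^sub>R a x + convection (ustar u (n + 1)) a x) a + V
      = L2_inner \<Omega> (\<lambda>x. (1 / (2 * \<tau>)) *\<^sub>R (4 *\<^sub>R b x - c x) + 2 *\<^sub>R (2 *\<^sub>R X x - Y x)) a"
    using scheme[unfolded rotational_imex_step_def, rule_format, OF U P] L2_inner_commute[of \<Omega> "div_op a" "p (n + 1)"]
    unfolding V_def X_def Y_def a_def b_def c_def by linarith
  also have "L2_inner \<Omega> (\<lambda>x. (3 / (2 * \<tau>)) *\<^sub>R a x + convection (ustar u (n + 1)) a x) a = (3 / (2 * \<tau>)) * L2_inner \<Omega> a a"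
    by (simp only: L2_inner_add_left[OF scale[OF ua] cv ua] L2_inner_scaleR_left conv[folded a_def] add_0_right)
  also have "L2_inner \<Omega> (\<lambda>x. (1 / (2 * \<tau>)) *\<^sub>R (4 *\<^sub>R b x - c x) + 2 *\<^sub>R (2 *\<^sub>R X x - Y x)) a
      = 1 / (2 * \<tau>) * L2_inner \<Omega> (\<lambda>x. 4 *\<^sub>R b x - c x) a + 2 * L2_inner \<Omega> (\<lambda>x. 2 *\<^sub>R X x - Y x) a"
    by (simp only: L2_inner_add_left[OF scale[OF bc] scale[OF XY] ua] L2_inner_scaleR_left)
  \<comment> \<open>Multiplication by \<open>4 * \<tau>\<close> clears the denominators and matches
    the normalization of \<open>bdf2_energy\<close>.\<close>
  finally have eq: "4 * \<tau> * V = 8 * \<tau> * L2_inner \<Omega> (\<lambda>x. 2 *\<^sub>R X x - Y x) a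
      - 2 * (3 * L2_inner \<Omega> a a - L2_inner \<Omega> (\<lambda>x. 4 *\<^sub>R b x - c x) a)"
    using \<tau> by (simp add: field_simps)
  have "L2_inner \<Omega> (\<lambda>x. 3 *\<^sub>R a x - 4 *\<^sub>R b x + c x) a
      = L2_inner \<Omega> (\<lambda>x. 3 *\<^sub>R a x + (-1) *\<^sub>R (4 *\<^sub>R b x - c x)) a"
    by (simp add: algebra_simps)
  also have "\<dots> = 3 * L2_inner \<Omega> a a + - 1 * L2_inner \<Omega> (\<lambda>x. 4 *\<^sub>R b x - c x) a"
    by (simp only: L2_inner_add_left[OF scale[OF ua] scale[OF bc] ua] L2_inner_scaleR_left)
  also have "3 * L2_inner \<Omega> a a + - 1 * L2_inner \<Omega> (\<lambda>x. 4 *\<^sub>R b x - c x) a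
      = 3 * L2_inner \<Omega> a a - L2_inner \<Omega> (\<lambda>x. 4 *\<^sub>R b x - c x) a" by simp
  finally have "4 * \<tau> * V = 8 * \<tau> * L2_inner \<Omega> (\<lambda>x. 2 *\<^sub>R X x - Y x) a
      - 2 * L2_inner \<Omega> (\<lambda>x. 3 *\<^sub>R a x - 4 *\<^sub>R b x + c x) a"
    using eq by simp
  moreover have "4 * \<tau> * (m * min \<gamma> 1 * (L2_norm \<Omega> (grad a))\<^sup>2) \<le> 4 * \<tau> * V"
    using coercive \<tau> by (intro mult_left_mono) auto
  ultimately show ?thesis
    using energy unfolding s a_def[symmetric] b_def[symmetric] c_def[symmetric] by linarith
qed

end

text \<open>The dimension enters only through the assumption on \<open>curl\<close>, so this covers
  the plane and the space alike.\<close>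

lemma rotational_imex_stability:
  fixes \<Omega> :: "(real^'d) set" and curl :: "(real^'d \<Rightarrow> real^'d) \<Rightarrow> real^'d \<Rightarrow> 'c::real_inner"
  assumes curl: "\<And>v x. curl v x \<bullet> curl v x = grad v x \<bullet> grad v x - trace (grad v x ** grad v x)"
    and dom: "lipschitz_domain \<Omega>" and mesh: "simplicial_mesh \<Omega> \<T>"
    and T: "T > 0" and \<gamma>: "\<gamma> > 0" and N: "N \<ge> 2" and \<tau>: "\<tau> = T / real N" and min: "0 < \<nu>\<^sub>m\<^sub>i\<^sub>n"
    and visc: "prescribed_viscosity \<Omega> T N \<nu>\<^sub>m\<^sub>i\<^sub>n \<nu>\<^sub>m\<^sub>a\<^sub>x \<nu> \<nu>star \<kappa> \<or>
       rheological_viscosity \<Omega> N \<nu>\<^sub>m\<^sub>i\<^sub>n \<nu>\<^sub>m\<^sub>a\<^sub>x u \<nu> \<nu>star d\<nu> \<kappa>"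
    and d\<nu>: "\<forall>n \<le> N. W1inf_gradient \<Omega> (\<nu> n) (d\<nu> n) \<and> Linf_norm \<Omega> (d\<nu> n) \<le> ereal \<kappa>"
    and u: "\<forall>n \<le> N. u n \<in> velocity_space \<Omega> \<T>"
    and p: "\<forall>n \<in> {2..N}. p n \<in> pressure_space \<Omega> \<T>"
    and scheme: "\<forall>n \<in> {1..<N}. rotational_imex_step curl \<Omega> \<T> \<tau> \<gamma> u p \<nu>star d\<nu> n"
    and conv: "\<forall>n \<in> {1..<N}. L2_inner \<Omega> (convection (ustar u (n + 1)) (u (n + 1))) (u (n + 1)) = 0"
    and \<epsilon>: "0 < \<epsilon>" "\<epsilon> \<le> 1 / 40"
  shows "let \<gamma>' = min \<gamma> 1;
           C = (L2_norm \<Omega> (ustar u 2))\<^sup>2 + (L2_norm \<Omega> (u 1))\<^sup>2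
               + 32 * \<epsilon> * \<gamma>' * \<tau> * \<nu>\<^sub>m\<^sub>i\<^sub>n *
                 (5 * (L2_norm \<Omega> (grad (u 1)))\<^sup>2 + (L2_norm \<Omega> (grad (u 0)))\<^sup>2)
       in (L2_norm \<Omega> (u N))\<^sup>2 + (L2_norm \<Omega> (ustar u (N + 1)))\<^sup>2
          + 8 * \<epsilon> * \<gamma>' * \<tau> * \<nu>\<^sub>m\<^sub>i\<^sub>n *
            (5 * (L2_norm \<Omega> (grad (u N)))\<^sup>2 + (L2_norm \<Omega> (grad (u (N - 1))))\<^sup>2)
          + 4 * (1 - 40 * \<epsilon>) * \<gamma>' * \<tau> * (\<Sum>n = 2..N. \<nu>\<^sub>m\<^sub>i\<^sub>n * (L2_norm \<Omega> (grad (u n)))\<^sup>2)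
          \<le> C * exp (\<kappa>\<^sup>2 * T / (\<epsilon> * \<gamma>' * \<nu>\<^sub>m\<^sub>i\<^sub>n))"
proof -
  interpret jordan_domain \<Omega>
    using dom lipschitz_domain_frontier_negligible[OF dom mesh]
    by unfold_locales (auto simp: lipschitz_domain_def)
  note tr = velocity_space_zero_trace_lipschitz[OF open_domain mesh]
  \<comment> \<open>With this weight the viscous term \<open>4 * \<tau> *
    (\<nu>\<^sub>m\<^sub>i\<^sub>n * min \<gamma> 1 * ...)\<close> is \<open>4 / \<epsilon>\<close>
    times \<open>G\<close>, and \<open>\<kappa>\<^sup>2 / h\<close> is the rate in the
    exponential.\<close>
  define h where "h = \<epsilon> * min \<gamma> 1 * \<nu>\<^sub>m\<^sub>i\<^sub>n"
  define E where "E n = (L2_norm \<Omega> (u n))\<^sup>2 + (L2_norm \<Omega> (ustar u (n + 1)))\<^sup>2" for n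
  define G where "G n = h * \<tau> * (L2_norm \<Omega> (grad (u n)))\<^sup>2" for n
  define a where "a = \<tau> * (\<kappa>\<^sup>2 / h)"
  have \<tau>0: "\<tau> > 0" using T N by (simp add: \<tau>)
  have h: "h > 0" using \<epsilon> \<gamma> min by (simp add: h_def)
  have a: "0 \<le> a" using \<tau>0 h by (simp add: a_def)
  have E0: "0 \<le> E n" and G0: "0 \<le> G n" for n
    using h \<tau>0 by (simp_all add: E_def G_def)
  have step: "E (n + 1) + 4 / \<epsilon> * G (n + 1) \<le> (1 + a) * E n + (1 + a) * (128 * G n + 32 * G (n - 1))"
    if n: "n \<in> {1..<N}" for n
  proof -
    have star: "ustar u (n + 1) \<in> velocity_space \<Omega> \<T>"
      using n u by (intro ustar_velocity_space) auto
    have \<nu>: "ess_bounded (lebesgue_on \<Omega>) (\<nu>star (n + 1)) \<and> (AE x in lebesgue_on \<Omega>. \<nu>\<^sub>m\<^sub>i\<^sub>n \<le> \<nu>star (n + 1) x)"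
      using visc
    proof
      assume "prescribed_viscosity \<Omega> T N \<nu>\<^sub>m\<^sub>i\<^sub>n \<nu>\<^sub>m\<^sub>a\<^sub>x \<nu> \<nu>star \<kappa>"
      moreover have "\<nu> (n + 1) \<in> borel_measurable (lebesgue_on \<Omega>)"
        using d\<nu> n unfolding W1inf_gradient_def by auto
      ultimately show ?thesis
        using prescribed_viscosity_bounds n T min by blast
    next
      assume "rheological_viscosity \<Omega> N \<nu>\<^sub>m\<^sub>i\<^sub>n \<nu>\<^sub>m\<^sub>a\<^sub>x u \<nu> \<nu>star d\<nu> \<kappa>"
      then show ?thesis
        using rheological_viscosity_bounds n min tr[OF star] by blast
    qed
    have D: "ess_bounded (lebesgue_on \<Omega>) (d\<nu> k)" "AE x in lebesgue_on \<Omega>. norm (d\<nu> k x) \<le> \<kappa>"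
      if "k \<in> {n - 1, n}" for k
    proof -
      have "k \<le> N" using that n by auto
      then show "ess_bounded (lebesgue_on \<Omega>) (d\<nu> k)" "AE x in lebesgue_on \<Omega>. norm (d\<nu> k x) \<le> \<kappa>"
        using d\<nu> W1inf_gradient_ess_bounded by blast+
    qed
    have "(L2_norm \<Omega> (u (n + 1)))\<^sup>2 + (L2_norm \<Omega> (ustar u (n + 2)))\<^sup>2
        + 4 * \<tau> * (\<nu>\<^sub>m\<^sub>i\<^sub>n * min \<gamma> 1 * (L2_norm \<Omega> (grad (u (n + 1))))\<^sup>2)
      \<le> (L2_norm \<Omega> (u n))\<^sup>2 + (1 + a) * (L2_norm \<Omega> (ustar u (n + 1)))\<^sup>2
        + 16 * h * \<tau> * (1 + a) * (8 * (L2_norm \<Omega> (grad (u n)))\<^sup>2 + 2 * (L2_norm \<Omega> (grad (u (n - 1))))\<^sup>2)"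
      unfolding a_def
    proof (rule rotational_imex_energy_step[OF curl])
      show "zero_trace_lipschitz \<Omega> (u k)" if "k \<in> {n - 1, n, n + 1}" for k
        using that n u by (intro tr) auto
      show "u (n + 1) \<in> velocity_space \<Omega> \<T>" "p (n + 1) \<in> pressure_space \<Omega> \<T>"
        using n u p by auto
      show "ess_bounded (lebesgue_on \<Omega>) (d\<nu> k)" "AE x in lebesgue_on \<Omega>. norm (d\<nu> k x) \<le> \<kappa>"
        if "k \<in> {n - 1, n}" for k
        using that by (rule D)+
    qed (use n \<tau>0 \<gamma> h min scheme conv \<nu> in auto)
    \<comment> \<open>The constants 128 and 32 are \<open>16 * 8\<close> and
      \<open>16 * 2\<close>.\<close>
    moreover have "16 * h * \<tau> * (1 + a) * (8 * (L2_norm \<Omega> (grad (u n)))\<^sup>2 + 2 * (L2_norm \<Omega> (grad (u (n - 1))))\<^sup>2)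
        = (1 + a) * (128 * G n + 32 * G (n - 1))"
      by (simp add: G_def algebra_simps)
    moreover have "4 * \<tau> * (\<nu>\<^sub>m\<^sub>i\<^sub>n * min \<gamma> 1 * (L2_norm \<Omega> (grad (u (n + 1))))\<^sup>2) = 4 / \<epsilon> * G (n + 1)"
      using \<epsilon> by (simp add: G_def h_def)
    moreover have "(L2_norm \<Omega> (u n))\<^sup>2 + (1 + a) * (L2_norm \<Omega> (ustar u (n + 1)))\<^sup>2 \<le> (1 + a) * E n"
      using a by (simp add: E_def algebra_simps)
    moreover have "E (n + 1) = (L2_norm \<Omega> (u (n + 1)))\<^sup>2 + (L2_norm \<Omega> (ustar u (n + 2)))\<^sup>2"
      by (simp add: E_def)
    ultimately show ?thesis by linarith
  qed
  \<comment> \<open>This is exactly the restriction \<open>\<epsilon> \<le> 1 / 40\<close>.\<close>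
  have "160 \<le> 4 / \<epsilon>" using \<epsilon> by (simp add: field_simps)
  with N a E0 G0 step have "E N + 32 * (5 * G N + G (N - 1)) + (4 / \<epsilon> - 160) * (\<Sum>n=2..N. G n)
      \<le> (1 + a) ^ (N - 1) * (E 1 + 32 * (5 * G 1 + G 0))"
    by (intro gronwall_two_step) auto
  also have "\<dots> \<le> exp (\<kappa>\<^sup>2 * T / h) * (E 1 + 32 * (5 * G 1 + G 0))"
  proof (rule mult_right_mono)
    \<comment> \<open>There are only \<open>N - 1\<close> steps; one further factor is added so that
      \<open>real N * \<tau>\<close> becomes \<open>T\<close>.\<close>
    have "(1 + a) ^ (N - 1) \<le> (1 + a) ^ N" using a by (intro power_increasing) auto
    also have "\<dots> \<le> exp a ^ N" using a by (intro power_mono exp_ge_add_one_self) auto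
    also have "\<dots> = exp (real N * a)" by (rule exp_of_nat_mult[symmetric])
    also have "real N * a = \<kappa>\<^sup>2 * T / h" using N by (simp add: a_def \<tau>)
    finally show "(1 + a) ^ (N - 1) \<le> exp (\<kappa>\<^sup>2 * T / h)" .
  qed (use E0 G0 in \<open>auto intro!: add_nonneg_nonneg\<close>)
  finally have main: "E N + 32 * (5 * G N + G (N - 1)) + (4 / \<epsilon> - 160) * (\<Sum>n=2..N. G n)
      \<le> exp (\<kappa>\<^sup>2 * T / h) * (E 1 + 32 * (5 * G 1 + G 0))" .
  have "(4 / \<epsilon> - 160) * (\<Sum>n=2..N. G n)
      = 4 * (1 - 40 * \<epsilon>) * min \<gamma> 1 * \<tau> * (\<Sum>n = 2..N. \<nu>\<^sub>m\<^sub>i\<^sub>n * (L2_norm \<Omega> (grad (u n)))\<^sup>2)"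
    using \<epsilon> by (simp add: G_def h_def sum_distrib_left[symmetric] field_simps)
  moreover have "8 * \<epsilon> * min \<gamma> 1 * \<tau> * \<nu>\<^sub>m\<^sub>i\<^sub>n *
        (5 * (L2_norm \<Omega> (grad (u N)))\<^sup>2 + (L2_norm \<Omega> (grad (u (N - 1))))\<^sup>2) = 8 * (5 * G N + G (N - 1))"
    by (simp add: G_def h_def algebra_simps)
  \<comment> \<open>The iteration controls the final gradients with factor 32, while the claim asks
    for 8.\<close>
  moreover have "8 * (5 * G N + G (N - 1)) \<le> 32 * (5 * G N + G (N - 1))"
    using G0[of N] G0[of "N - 1"] by simp
  moreover have "(L2_norm \<Omega> (ustar u 2))\<^sup>2 + (L2_norm \<Omega> (u 1))\<^sup>2 + 32 * \<epsilon> * min \<gamma> 1 * \<tau> * \<nu>\<^sub>m\<^sub>i\<^sub>n *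
        (5 * (L2_norm \<Omega> (grad (u 1)))\<^sup>2 + (L2_norm \<Omega> (grad (u 0)))\<^sup>2) = E 1 + 32 * (5 * G 1 + G 0)"
    by (simp add: E_def G_def h_def numeral_2_eq_2 algebra_simps)
  ultimately show ?thesis
    using main unfolding Let_def h_def[symmetric] E_def[of N] by (simp only: mult.commute[of "exp _"])
qed

text \<open>For a matrix \<open>A\<close>, the squared norm minus the trace of \<open>A ** A\<close>
  is the sum over pairs \<open>i < j\<close> of the squares of \<open>A $ i $ j - A $ j $ i\<close>.
  In the plane there is one pair; in space the three pairs are the components of the curl.\<close>

lemma curl2_inner: "curl2 v x \<bullet> curl2 v x = grad v x \<bullet> grad v x - trace (grad v x ** grad v x)"
  by (simp add: curl2_def inner_vec_def trace_def matrix_matrix_mult_def sum_2 algebra_simps)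

lemma curl3_inner: "curl3 v x \<bullet> curl3 v x = grad v x \<bullet> grad v x - trace (grad v x ** grad v x)"
  by (simp add: curl3_def inner_vec_def trace_def matrix_matrix_mult_def sum_3 algebra_simps)

theorem theorem4p4:
  shows "(\<forall>(\<Omega> :: (real^2) set) \<T> (T::real) (\<gamma>::real) (N::nat) (\<tau>::real) (\<nu>\<^sub>m\<^sub>i\<^sub>n::real) (\<nu>\<^sub>m\<^sub>a\<^sub>x::real) (\<kappa>::real)
        (u :: nat \<Rightarrow> real^2 \<Rightarrow> real^2) (p :: nat \<Rightarrow> real^2 \<Rightarrow> real)
        (\<nu> :: nat \<Rightarrow> real^2 \<Rightarrow> real) (\<nu>star :: nat \<Rightarrow> real^2 \<Rightarrow> real) (d\<nu> :: nat \<Rightarrow> real^2 \<Rightarrow> real^2) (\<epsilon>::real).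
      lipschitz_domain \<Omega> \<and> simplicial_mesh \<Omega> \<T> \<and>
      T > 0 \<and> \<gamma> > 0 \<and> N \<ge> 2 \<and> \<tau> = T / real N \<and>
      0 < \<nu>\<^sub>m\<^sub>i\<^sub>n \<and> \<nu>\<^sub>m\<^sub>i\<^sub>n \<le> \<nu>\<^sub>m\<^sub>a\<^sub>x \<and>
      (prescribed_viscosity \<Omega> T N \<nu>\<^sub>m\<^sub>i\<^sub>n \<nu>\<^sub>m\<^sub>a\<^sub>x \<nu> \<nu>star \<kappa> \<or>
       rheological_viscosity \<Omega> N \<nu>\<^sub>m\<^sub>i\<^sub>n \<nu>\<^sub>m\<^sub>a\<^sub>x u \<nu> \<nu>star d\<nu> \<kappa>) \<and>
      (\<forall>n \<le> N. W1inf_gradient \<Omega> (\<nu> n) (d\<nu> n) \<and> Linf_norm \<Omega> (d\<nu> n) \<le> ereal \<kappa>) \<and>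
      (\<forall>n \<le> N. u n \<in> velocity_space \<Omega> \<T>) \<and>
      (\<forall>n \<in> {2..N}. p n \<in> pressure_space \<Omega> \<T>) \<and>
      (\<forall>n \<in> {1..<N}. rotational_imex_step curl2 \<Omega> \<T> \<tau> \<gamma> u p \<nu>star d\<nu> n) \<and>
      (\<forall>n \<in> {1..<N}. L2_inner \<Omega> (convection (ustar u (n + 1)) (u (n + 1))) (u (n + 1)) = 0) \<and>
      0 < \<epsilon> \<and> \<epsilon> \<le> 1 / 40 \<longrightarrow>
      (let \<gamma>' = min \<gamma> 1;
           C = (L2_norm \<Omega> (ustar u 2))\<^sup>2 + (L2_norm \<Omega> (u 1))\<^sup>2
               + 32 * \<epsilon> * \<gamma>' * \<tau> * \<nu>\<^sub>m\<^sub>i\<^sub>n *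
                 (5 * (L2_norm \<Omega> (grad (u 1)))\<^sup>2 + (L2_norm \<Omega> (grad (u 0)))\<^sup>2)
       in (L2_norm \<Omega> (u N))\<^sup>2 + (L2_norm \<Omega> (ustar u (N + 1)))\<^sup>2
          + 8 * \<epsilon> * \<gamma>' * \<tau> * \<nu>\<^sub>m\<^sub>i\<^sub>n *
            (5 * (L2_norm \<Omega> (grad (u N)))\<^sup>2 + (L2_norm \<Omega> (grad (u (N - 1))))\<^sup>2)
          + 4 * (1 - 40 * \<epsilon>) * \<gamma>' * \<tau> * (\<Sum>n = 2..N. \<nu>\<^sub>m\<^sub>i\<^sub>n * (L2_norm \<Omega> (grad (u n)))\<^sup>2)
          \<le> C * exp (\<kappa>\<^sup>2 * T / (\<epsilon> * \<gamma>' * \<nu>\<^sub>m\<^sub>i\<^sub>n))))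
    \<and>
    (\<forall>(\<Omega> :: (real^3) set) \<T> (T::real) (\<gamma>::real) (N::nat) (\<tau>::real) (\<nu>\<^sub>m\<^sub>i\<^sub>n::real) (\<nu>\<^sub>m\<^sub>a\<^sub>x::real) (\<kappa>::real)
        (u :: nat \<Rightarrow> real^3 \<Rightarrow> real^3) (p :: nat \<Rightarrow> real^3 \<Rightarrow> real)
        (\<nu> :: nat \<Rightarrow> real^3 \<Rightarrow> real) (\<nu>star :: nat \<Rightarrow> real^3 \<Rightarrow> real) (d\<nu> :: nat \<Rightarrow> real^3 \<Rightarrow> real^3) (\<epsilon>::real).
      lipschitz_domain \<Omega> \<and> simplicial_mesh \<Omega> \<T> \<and>
      T > 0 \<and> \<gamma> > 0 \<and> N \<ge> 2 \<and> \<tau> = T / real N \<and>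
      0 < \<nu>\<^sub>m\<^sub>i\<^sub>n \<and> \<nu>\<^sub>m\<^sub>i\<^sub>n \<le> \<nu>\<^sub>m\<^sub>a\<^sub>x \<and>
      (prescribed_viscosity \<Omega> T N \<nu>\<^sub>m\<^sub>i\<^sub>n \<nu>\<^sub>m\<^sub>a\<^sub>x \<nu> \<nu>star \<kappa> \<or>
       rheological_viscosity \<Omega> N \<nu>\<^sub>m\<^sub>i\<^sub>n \<nu>\<^sub>m\<^sub>a\<^sub>x u \<nu> \<nu>star d\<nu> \<kappa>) \<and>
      (\<forall>n \<le> N. W1inf_gradient \<Omega> (\<nu> n) (d\<nu> n) \<and> Linf_norm \<Omega> (d\<nu> n) \<le> ereal \<kappa>) \<and>
      (\<forall>n \<le> N. u n \<in> velocity_space \<Omega> \<T>) \<and>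
      (\<forall>n \<in> {2..N}. p n \<in> pressure_space \<Omega> \<T>) \<and>
      (\<forall>n \<in> {1..<N}. rotational_imex_step curl3 \<Omega> \<T> \<tau> \<gamma> u p \<nu>star d\<nu> n) \<and>
      (\<forall>n \<in> {1..<N}. L2_inner \<Omega> (convection (ustar u (n + 1)) (u (n + 1))) (u (n + 1)) = 0) \<and>
      0 < \<epsilon> \<and> \<epsilon> \<le> 1 / 40 \<longrightarrow>
      (let \<gamma>' = min \<gamma> 1;
           C = (L2_norm \<Omega> (ustar u 2))\<^sup>2 + (L2_norm \<Omega> (u 1))\<^sup>2
               + 32 * \<epsilon> * \<gamma>' * \<tau> * \<nu>\<^sub>m\<^sub>i\<^sub>n *
                 (5 * (L2_norm \<Omega> (grad (u 1)))\<^sup>2 + (L2_norm \<Omega> (grad (u 0)))\<^sup>2)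
       in (L2_norm \<Omega> (u N))\<^sup>2 + (L2_norm \<Omega> (ustar u (N + 1)))\<^sup>2
          + 8 * \<epsilon> * \<gamma>' * \<tau> * \<nu>\<^sub>m\<^sub>i\<^sub>n *
            (5 * (L2_norm \<Omega> (grad (u N)))\<^sup>2 + (L2_norm \<Omega> (grad (u (N - 1))))\<^sup>2)
          + 4 * (1 - 40 * \<epsilon>) * \<gamma>' * \<tau> * (\<Sum>n = 2..N. \<nu>\<^sub>m\<^sub>i\<^sub>n * (L2_norm \<Omega> (grad (u n)))\<^sup>2)
          \<le> C * exp (\<kappa>\<^sup>2 * T / (\<epsilon> * \<gamma>' * \<nu>\<^sub>m\<^sub>i\<^sub>n))))"
  by (intro conjI allI impI; elim conjE)
     (rule rotational_imex_stability[OF curl2_inner] rotational_imex_stability[OF curl3_inner]; assumption)+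

end
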